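(* Let $X$ be a variety over an algebraically closed field $k$ of characteristic $\neq2$, let $V\to X$ be a vector bundle of rank $7$ and $M$ a line bundle on $X$, and let $\gamma:\bigwedge^3V\to M^{\otimes3}$ and $\beta:\mathrm{Sym}^2V\to M^{\otimes2}$ be (locally) compatible forms, with $\beta$ nondegenerate. Let $F_1\subset V$ be a $\gamma$-isotropic line bundle, and let $\phi:V\to F_1^*\otimes V^*\otimes M^{\otimes3}$ be the map defined by $\gamma$. Then the bundle $E_{F_1}=\ker(\phi)$ has rank $3$ and is $\beta$-isotropic.
   Context: On a vector space, an alternating trilinear form $\gamma$ and a nondegenerate symmetric bilinear form $\beta$ are compatible if $2\gamma(u,v,\gamma(u,v,\cdot)^\dagger)=\beta(u,u)\beta(v,v)-\beta(u,v)^2$ for all $u,v$, where $\dagger:V^*\to V$ is the inverse of $v\mapsto\beta(v,\cdot)$. Forms on bundles with values in $M^{\otimes3}$, $M^{\otimes2}$ are locally compatible if, after locally trivializing $M$ (with the induced trivializations of $M^{\otimes2},M^{\otimes3}$), they are compatible on fibers. A $2$-dimensional subspace of a fiber is $\gamma$-isotropic if $\gamma(u,v,\cdot)\equiv0$ for all $u,v$ in it; a line is $\gamma$-isotropic if it lies in a $2$-dimensional $\gamma$-isotropic subspace; a line subbundle is $\gamma$-isotropic if each fiber is. A subbundle is $\beta$-isotropic if $\beta$ restricts to zero on it. *)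

theory Defs
  imports
    "HOL-Analysis.Abstract_Topology"
    "HOL-Library.Function_Algebras"
    "HOL-Computational_Algebra.Polynomial"
begin

section \<open>Varieties as spaces with functions\<close>

text \<open>
  Varieties over an algebraically closed field \<open>k\<close> are taken in the classical language: a
  topological space of (closed) points together with its sheaf of \<open>k\<close>-valued regular functions,
  covered by finitely many affine algebraic sets, and separated.  Irreducibility is not required.

  Local functions and sections are total functions of which only the values on the open set in
  question matter; \<open>is_sheaf\<close> includes this convention.
\<close>

definition is_sheaf :: "'x topology \<Rightarrow> ('x set \<Rightarrow> ('x \<Rightarrow> 'a) set) \<Rightarrow> bool" where
  "is_sheaf T \<F> \<longleftrightarrow>
     (\<forall>U s t. openin T U \<longrightarrow> s \<in> \<F> U \<longrightarrow> (\<forall>x\<in>U. t x = s x) \<longrightarrow> t \<in> \<F> U) \<and>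
     (\<forall>U W s. openin T U \<longrightarrow> openin T W \<longrightarrow> W \<subseteq> U \<longrightarrow> s \<in> \<F> U \<longrightarrow> s \<in> \<F> W) \<and>
     (\<forall>U s. openin T U \<longrightarrow> (\<forall>x\<in>U. \<exists>W. openin T W \<and> x \<in> W \<and> W \<subseteq> U \<and> s \<in> \<F> W) \<longrightarrow> s \<in> \<F> U)"

record ('x, 'k) fun_space =
  topo :: "'x topology"
  reg :: "'x set \<Rightarrow> ('x \<Rightarrow> 'k) set"

abbreviation points :: "('x, 'k) fun_space \<Rightarrow> 'x set" where
  "points X \<equiv> topspace (topo X)"

definition space_with_functions :: "('x, 'k::field) fun_space \<Rightarrow> bool" where
  "space_with_functions X \<longleftrightarrow>
     is_sheaf (topo X) (reg X) \<and>
     (\<forall>U. openin (topo X) U \<longrightarrow>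
        (\<forall>c. (\<lambda>_. c) \<in> reg X U) \<and>
        (\<forall>f\<in>reg X U. \<forall>g\<in>reg X U. (\<lambda>x. f x + g x) \<in> reg X U \<and> (\<lambda>x. f x * g x) \<in> reg X U) \<and>
        (\<forall>f\<in>reg X U. openin (topo X) {x \<in> U. f x \<noteq> 0} \<and>
                      (\<lambda>x. inverse (f x)) \<in> reg X {x \<in> U. f x \<noteq> 0}))"

definition morphism ::
  "('y, 'k) fun_space \<Rightarrow> ('x, 'k) fun_space \<Rightarrow> ('y \<Rightarrow> 'x) \<Rightarrow> bool" where
  "morphism Y X f \<longleftrightarrow>
     continuous_map (topo Y) (topo X) f \<and>
     (\<forall>U r. openin (topo X) U \<longrightarrow> r \<in> reg X U \<longrightarrow> r \<circ> f \<in> reg Y {y \<in> points Y. f y \<in> U})"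

definition isomorphic :: "('y, 'k) fun_space \<Rightarrow> ('x, 'k) fun_space \<Rightarrow> bool" where
  "isomorphic Y X \<longleftrightarrow>
     (\<exists>f g. morphism Y X f \<and> morphism X Y g \<and>
            (\<forall>y\<in>points Y. g (f y) = y) \<and> (\<forall>x\<in>points X. f (g x) = x))"

definition open_subspace :: "('x, 'k) fun_space \<Rightarrow> 'x set \<Rightarrow> ('x, 'k) fun_space" where
  "open_subspace X U = \<lparr>topo = subtopology (topo X) U, reg = reg X\<rparr>"

text \<open>
  Points of affine \<open>n\<close>-space are sequences vanishing from index \<open>n\<close> on, so that \<open>n\<close> can be
  quantified over.
\<close>

definition affine_space :: "nat \<Rightarrow> (nat \<Rightarrow> 'k::field) set" where
  "affine_space n = {p. \<forall>i\<ge>n. p i = 0}"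

inductive_set poly_funs :: "nat \<Rightarrow> ((nat \<Rightarrow> 'k::field) \<Rightarrow> 'k) set" for n where
  const: "(\<lambda>_. c) \<in> poly_funs n"
| coord: "i < n \<Longrightarrow> (\<lambda>p. p i) \<in> poly_funs n"
| add: "f \<in> poly_funs n \<Longrightarrow> g \<in> poly_funs n \<Longrightarrow> (\<lambda>p. f p + g p) \<in> poly_funs n"
| mult: "f \<in> poly_funs n \<Longrightarrow> g \<in> poly_funs n \<Longrightarrow> (\<lambda>p. f p * g p) \<in> poly_funs n"

definition algebraic_set :: "nat \<Rightarrow> (nat \<Rightarrow> 'k::field) set \<Rightarrow> bool" where
  "algebraic_set n Z \<longleftrightarrow> (\<exists>S \<subseteq> poly_funs n. Z = {p \<in> affine_space n. \<forall>f\<in>S. f p = 0})"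

definition zariski :: "nat \<Rightarrow> (nat \<Rightarrow> 'k::field) topology" where
  "zariski n = topology_generated_by ((\<lambda>f. {p \<in> affine_space n. f p \<noteq> 0}) ` poly_funs n)"

definition affine_variety :: "nat \<Rightarrow> (nat \<Rightarrow> 'k::field) set \<Rightarrow> (nat \<Rightarrow> 'k, 'k) fun_space" where
  "affine_variety n Z =
     \<lparr>topo = subtopology (zariski n) Z,
      reg = (\<lambda>U. {r. \<forall>p\<in>U. \<exists>W. openin (subtopology (zariski n) Z) W \<and> p \<in> W \<and> W \<subseteq> U \<and>
                     (\<exists>f\<in>poly_funs n. \<exists>g\<in>poly_funs n. \<forall>q\<in>W. g q \<noteq> 0 \<and> r q = f q / g q)})\<rparr>"

definition affine_open :: "('x, 'k::field) fun_space \<Rightarrow> 'x set \<Rightarrow> bool" where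
  "affine_open X U \<longleftrightarrow> openin (topo X) U \<and>
     (\<exists>n Z. algebraic_set n Z \<and> isomorphic (open_subspace X U) (affine_variety n Z))"

text \<open>
  Separatedness: two morphisms to \<open>X\<close> agree on a closed set.  As closedness is local, it suffices
  to test this on morphisms from affine varieties.
\<close>

definition separated :: "('x, 'k::field) fun_space \<Rightarrow> bool" where
  "separated X \<longleftrightarrow>
     (\<forall>n Z f g. algebraic_set n Z \<longrightarrow> morphism (affine_variety n Z) X f \<longrightarrow>
        morphism (affine_variety n Z) X g \<longrightarrow>
        closedin (topo (affine_variety n Z)) {z \<in> points (affine_variety n Z). f z = g z})"

definition variety :: "('x, 'k::field) fun_space \<Rightarrow> bool" where
  "variety X \<longleftrightarrow>
     space_with_functions X \<and>
     (\<exists>\<U>. finite \<U> \<and> (\<forall>U\<in>\<U>. affine_open X U) \<and> \<Union>\<U> = points X) \<and>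
     separated X"


section \<open>Vector bundles\<close>

text \<open>
  A bundle consists of the fibers over the points of the base and the regular sections over its
  open subsets.  All fibers are subspaces of a common ambient vector space, with scalar
  multiplication \<open>scl\<close>.  This is no restriction (every family of vector spaces embeds into its
  direct sum), and the ambient space plays no role in identifying different fibers: which sections
  are regular is recorded by \<open>sec\<close> alone.
\<close>

record ('x, 'k, 'v) vbundle =
  scl :: "'k \<Rightarrow> 'v \<Rightarrow> 'v"
  fib :: "'x \<Rightarrow> 'v set"
  sec :: "'x set \<Rightarrow> ('x \<Rightarrow> 'v) set"

text \<open>
  A frame \<open>e\<^sub>0, \<dots>, e\<^sub>n\<^sub>-\<^sub>1\<close> over \<open>U\<close> is the same as a trivialization \<open>U \<times> k\<^sup>n \<cong> E|\<^sub>U\<close>.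
\<close>

definition local_frame ::
  "('x, 'k::field) fun_space \<Rightarrow> ('x, 'k, 'v::ab_group_add) vbundle \<Rightarrow> 'x set \<Rightarrow> nat \<Rightarrow>
     (nat \<Rightarrow> 'x \<Rightarrow> 'v) \<Rightarrow> bool" where
  "local_frame X E U n e \<longleftrightarrow>
     (\<forall>x\<in>U. inj_on (\<lambda>i. e i x) {..<n} \<and>
            \<not> module.dependent (scl E) ((\<lambda>i. e i x) ` {..<n}) \<and>
            module.span (scl E) ((\<lambda>i. e i x) ` {..<n}) = fib E x) \<and>
     (\<forall>W f. openin (topo X) W \<longrightarrow> W \<subseteq> U \<longrightarrow>
        ((\<lambda>x. \<Sum>i<n. scl E (f i x) (e i x)) \<in> sec E W \<longleftrightarrow> (\<forall>i<n. f i \<in> reg X W)))"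

definition vector_bundle ::
  "('x, 'k::field) fun_space \<Rightarrow> nat \<Rightarrow> ('x, 'k, 'v::ab_group_add) vbundle \<Rightarrow> bool" where
  "vector_bundle X n E \<longleftrightarrow>
     vector_space (scl E) \<and>
     (\<forall>x\<in>points X. module.subspace (scl E) (fib E x)) \<and>
     is_sheaf (topo X) (sec E) \<and>
     (\<forall>U. openin (topo X) U \<longrightarrow> (\<forall>s\<in>sec E U. \<forall>x\<in>U. s x \<in> fib E x)) \<and>
     (\<forall>x\<in>points X. \<exists>U e. openin (topo X) U \<and> x \<in> U \<and> local_frame X E U n e)"

abbreviation line_bundle ::
  "('x, 'k::field) fun_space \<Rightarrow> ('x, 'k, 'v::ab_group_add) vbundle \<Rightarrow> bool" where
  "line_bundle X L \<equiv> vector_bundle X 1 L"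

text \<open>
  A family of subspaces \<open>F x \<subseteq> E x\<close> is a subbundle of rank \<open>r\<close> if it is a vector bundle of rank \<open>r\<close>
  with the sections of \<open>E\<close> lying in it: locally, it is spanned by \<open>r\<close> regular sections of \<open>E\<close> that
  are linearly independent in every fiber.
\<close>

definition restrict_vbundle ::
  "('x, 'k, 'v) vbundle \<Rightarrow> ('x \<Rightarrow> 'v set) \<Rightarrow> ('x, 'k, 'v) vbundle" where
  "restrict_vbundle E F = \<lparr>scl = scl E, fib = F, sec = (\<lambda>U. {s \<in> sec E U. \<forall>x\<in>U. s x \<in> F x})\<rparr>"

definition subbundle ::
  "('x, 'k::field) fun_space \<Rightarrow> ('x, 'k, 'v::ab_group_add) vbundle \<Rightarrow> nat \<Rightarrow> ('x \<Rightarrow> 'v set) \<Rightarrow> bool"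
  where
  "subbundle X E r F \<longleftrightarrow>
     (\<forall>x\<in>points X. F x \<subseteq> fib E x) \<and> vector_bundle X r (restrict_vbundle E F)"


subsection \<open>Homomorphisms, duals and tensor products\<close>

definition linear_map_on ::
  "('k \<Rightarrow> 'v \<Rightarrow> 'v) \<Rightarrow> ('k \<Rightarrow> 'w \<Rightarrow> 'w) \<Rightarrow> 'v::plus set \<Rightarrow> 'w::plus set \<Rightarrow> ('v \<Rightarrow> 'w) \<Rightarrow> bool" where
  "linear_map_on s t A B h \<longleftrightarrow>
     (\<forall>v\<in>A. h v \<in> B) \<and>
     (\<forall>u\<in>A. \<forall>v\<in>A. h (u + v) = h u + h v) \<and>
     (\<forall>c. \<forall>v\<in>A. h (s c v) = t c (h v))"

text \<open>Linear maps between fibers are extended by \<open>0\<close>, so that each is one function.\<close>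

definition hom_bundle ::
  "('x, 'k) fun_space \<Rightarrow> ('x, 'k, 'v::ab_group_add) vbundle \<Rightarrow> ('x, 'k, 'w::ab_group_add) vbundle
     \<Rightarrow> ('x, 'k, 'v \<Rightarrow> 'w) vbundle" where
  "hom_bundle X E F =
     (let H = (\<lambda>x. {h. linear_map_on (scl E) (scl F) (fib E x) (fib F x) h \<and>
                       (\<forall>v. v \<notin> fib E x \<longrightarrow> h v = 0)})
      in \<lparr>scl = (\<lambda>c h v. scl F c (h v)),
          fib = H,
          sec = (\<lambda>U. {h. (\<forall>x\<in>U. h x \<in> H x) \<and>
                 (\<forall>W s. openin (topo X) W \<longrightarrow> W \<subseteq> U \<longrightarrow> s \<in> sec E W \<longrightarrow>
                    (\<lambda>x. h x (s x)) \<in> sec F W)})\<rparr>)"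

definition structure_bundle :: "('x, 'k::field) fun_space \<Rightarrow> ('x, 'k, 'k) vbundle" where
  "structure_bundle X = \<lparr>scl = (*), fib = (\<lambda>_. UNIV), sec = reg X\<rparr>"

definition dual_bundle ::
  "('x, 'k::field) fun_space \<Rightarrow> ('x, 'k, 'v::ab_group_add) vbundle \<Rightarrow> ('x, 'k, 'v \<Rightarrow> 'k) vbundle"
  where
  "dual_bundle X E = hom_bundle X E (structure_bundle X)"

text \<open>
  \<open>E \<otimes> F\<close> is modelled as \<open>Hom(E\<^sup>*, F)\<close>, where \<open>e \<otimes> f\<close> is the map \<open>\<xi> \<mapsto> \<xi>(e) f\<close>; this is the tensor
  product for bundles of finite rank.
\<close>

definition tensor_bundle ::
  "('x, 'k::field) fun_space \<Rightarrow> ('x, 'k, 'v::ab_group_add) vbundle \<Rightarrow>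
     ('x, 'k, 'w::ab_group_add) vbundle \<Rightarrow> ('x, 'k, ('v \<Rightarrow> 'k) \<Rightarrow> 'w) vbundle" where
  "tensor_bundle X E F = hom_bundle X (dual_bundle X E) F"

definition pure_tensor ::
  "('x, 'k::field) fun_space \<Rightarrow> ('x, 'k, 'v::ab_group_add) vbundle \<Rightarrow>
     ('x, 'k, 'w::ab_group_add) vbundle \<Rightarrow> 'x \<Rightarrow> 'v \<Rightarrow> 'w \<Rightarrow> ('v \<Rightarrow> 'k) \<Rightarrow> 'w" where
  "pure_tensor X E F x e f = (\<lambda>\<xi>. if \<xi> \<in> fib (dual_bundle X E) x then scl F (\<xi> e) f else 0)"

abbreviation tensor_square ::
  "('x, 'k::field) fun_space \<Rightarrow> ('x, 'k, 'm::ab_group_add) vbundle \<Rightarrow>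
     ('x, 'k, ('m \<Rightarrow> 'k) \<Rightarrow> 'm) vbundle" where
  "tensor_square X M \<equiv> tensor_bundle X M M"

abbreviation tensor_cube ::
  "('x, 'k::field) fun_space \<Rightarrow> ('x, 'k, 'm::ab_group_add) vbundle \<Rightarrow>
     ('x, 'k, ('m \<Rightarrow> 'k) \<Rightarrow> ('m \<Rightarrow> 'k) \<Rightarrow> 'm) vbundle" where
  "tensor_cube X M \<equiv> tensor_bundle X M (tensor_square X M)"


section \<open>Forms and compatibility\<close>

subsection \<open>On a vector space\<close>

text \<open>Forms on a subspace \<open>A\<close> with values in a subspace \<open>B\<close>; scalar-valued forms have \<open>B = UNIV\<close>.\<close>

definition symmetric_bilinear ::
  "('k \<Rightarrow> 'v \<Rightarrow> 'v) \<Rightarrow> ('k \<Rightarrow> 'w \<Rightarrow> 'w) \<Rightarrow> 'v::plus set \<Rightarrow> 'w::plus set \<Rightarrow> ('v \<Rightarrow> 'v \<Rightarrow> 'w) \<Rightarrow> bool"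
  where
  "symmetric_bilinear s t A B b \<longleftrightarrow>
     (\<forall>u\<in>A. linear_map_on s t A B (\<lambda>v. b u v)) \<and>
     (\<forall>u\<in>A. linear_map_on s t A B (\<lambda>v. b v u)) \<and>
     (\<forall>u\<in>A. \<forall>v\<in>A. b u v = b v u)"

definition alternating_trilinear ::
  "('k \<Rightarrow> 'v \<Rightarrow> 'v) \<Rightarrow> ('k \<Rightarrow> 'w \<Rightarrow> 'w) \<Rightarrow> 'v::plus set \<Rightarrow> 'w::{plus,zero} set \<Rightarrow>
     ('v \<Rightarrow> 'v \<Rightarrow> 'v \<Rightarrow> 'w) \<Rightarrow> bool" where
  "alternating_trilinear s t A B g \<longleftrightarrow>
     (\<forall>u\<in>A. \<forall>v\<in>A. linear_map_on s t A B (\<lambda>w. g u v w)) \<and>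
     (\<forall>u\<in>A. \<forall>v\<in>A. linear_map_on s t A B (\<lambda>w. g u w v)) \<and>
     (\<forall>u\<in>A. \<forall>v\<in>A. linear_map_on s t A B (\<lambda>w. g w u v)) \<and>
     (\<forall>u\<in>A. \<forall>v\<in>A. g u u v = 0 \<and> g u v u = 0 \<and> g v u u = 0)"

definition nondegenerate :: "'v::zero set \<Rightarrow> ('v \<Rightarrow> 'v \<Rightarrow> 'w::zero) \<Rightarrow> bool" where
  "nondegenerate A b \<longleftrightarrow> (\<forall>u\<in>A. (\<forall>v\<in>A. b u v = 0) \<longrightarrow> u = 0)"

definition dagger :: "'v set \<Rightarrow> ('v \<Rightarrow> 'v \<Rightarrow> 'k) \<Rightarrow> ('v \<Rightarrow> 'k) \<Rightarrow> 'v" where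
  "dagger A b \<xi> = (THE v. v \<in> A \<and> (\<forall>w\<in>A. b v w = \<xi> w))"

definition compatible ::
  "('k::field \<Rightarrow> 'v \<Rightarrow> 'v) \<Rightarrow> 'v::ab_group_add set \<Rightarrow> ('v \<Rightarrow> 'v \<Rightarrow> 'v \<Rightarrow> 'k) \<Rightarrow> ('v \<Rightarrow> 'v \<Rightarrow> 'k) \<Rightarrow> bool"
  where
  "compatible s A g b \<longleftrightarrow>
     alternating_trilinear s (*) A UNIV g \<and>
     symmetric_bilinear s (*) A UNIV b \<and>
     nondegenerate A b \<and>
     (\<forall>u\<in>A. \<forall>v\<in>A. 2 * g u v (dagger A b (\<lambda>w. g u v w)) = b u u * b v v - (b u v)\<^sup>2)"

text \<open>Isotropy of subspaces of \<open>A\<close> with respect to a form on \<open>A\<close>.\<close>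

definition gamma_isotropic_plane ::
  "('k::field \<Rightarrow> 'v \<Rightarrow> 'v) \<Rightarrow> 'v::ab_group_add set \<Rightarrow> ('v \<Rightarrow> 'v \<Rightarrow> 'v \<Rightarrow> 'w::zero) \<Rightarrow> 'v set \<Rightarrow> bool"
  where
  "gamma_isotropic_plane s A g P \<longleftrightarrow>
     module.subspace s P \<and> P \<subseteq> A \<and> vector_space.dim s P = 2 \<and>
     (\<forall>u\<in>P. \<forall>v\<in>P. \<forall>w\<in>A. g u v w = 0)"

definition gamma_isotropic_line ::
  "('k::field \<Rightarrow> 'v \<Rightarrow> 'v) \<Rightarrow> 'v::ab_group_add set \<Rightarrow> ('v \<Rightarrow> 'v \<Rightarrow> 'v \<Rightarrow> 'w::zero) \<Rightarrow> 'v set \<Rightarrow> bool"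
  where
  "gamma_isotropic_line s A g L \<longleftrightarrow>
     module.subspace s L \<and> vector_space.dim s L = 1 \<and>
     (\<exists>P. gamma_isotropic_plane s A g P \<and> L \<subseteq> P)"


subsection \<open>On a bundle\<close>

text \<open>
  By the universal properties of \<open>Sym\<^sup>2 V\<close> and \<open>\<Lambda>\<^sup>3 V\<close>, morphisms from these bundles to \<open>L\<close> are
  fiberwise symmetric bilinear, respectively alternating trilinear, forms that take regular
  sections to regular sections.
\<close>

definition sym2_form ::
  "('x, 'k) fun_space \<Rightarrow> ('x, 'k, 'v::plus) vbundle \<Rightarrow> ('x, 'k, 'w::plus) vbundle \<Rightarrow>
     ('x \<Rightarrow> 'v \<Rightarrow> 'v \<Rightarrow> 'w) \<Rightarrow> bool" where
  "sym2_form X V L \<beta> \<longleftrightarrow>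
     (\<forall>x\<in>points X. symmetric_bilinear (scl V) (scl L) (fib V x) (fib L x) (\<beta> x)) \<and>
     (\<forall>U. openin (topo X) U \<longrightarrow> (\<forall>s1\<in>sec V U. \<forall>s2\<in>sec V U.
        (\<lambda>x. \<beta> x (s1 x) (s2 x)) \<in> sec L U))"

definition wedge3_form ::
  "('x, 'k) fun_space \<Rightarrow> ('x, 'k, 'v::plus) vbundle \<Rightarrow> ('x, 'k, 'w::{plus,zero}) vbundle \<Rightarrow>
     ('x \<Rightarrow> 'v \<Rightarrow> 'v \<Rightarrow> 'v \<Rightarrow> 'w) \<Rightarrow> bool" where
  "wedge3_form X V L \<gamma> \<longleftrightarrow>
     (\<forall>x\<in>points X. alternating_trilinear (scl V) (scl L) (fib V x) (fib L x) (\<gamma> x)) \<and>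
     (\<forall>U. openin (topo X) U \<longrightarrow> (\<forall>s1\<in>sec V U. \<forall>s2\<in>sec V U. \<forall>s3\<in>sec V U.
        (\<lambda>x. \<gamma> x (s1 x) (s2 x) (s3 x)) \<in> sec L U))"

definition nondegenerate_form ::
  "('x, 'k) fun_space \<Rightarrow> ('x, 'k, 'v::zero) vbundle \<Rightarrow> ('x \<Rightarrow> 'v \<Rightarrow> 'v \<Rightarrow> 'w::zero) \<Rightarrow> bool" where
  "nondegenerate_form X V \<beta> \<longleftrightarrow> (\<forall>x\<in>points X. nondegenerate (fib V x) (\<beta> x))"

text \<open>
  A frame \<open>e\<close> of \<open>M\<close> induces the frames \<open>e \<otimes> e\<close> and \<open>e \<otimes> e \<otimes> e\<close> of its tensor powers; \<open>b\<close> and \<open>g\<close>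
  below are the fibers of the forms in these trivializations.
\<close>

definition locally_compatible ::
  "('x, 'k::field) fun_space \<Rightarrow> ('x, 'k, 'v::ab_group_add) vbundle \<Rightarrow>
     ('x, 'k, 'm::ab_group_add) vbundle \<Rightarrow>
     ('x \<Rightarrow> 'v \<Rightarrow> 'v \<Rightarrow> 'v \<Rightarrow> ('m \<Rightarrow> 'k) \<Rightarrow> ('m \<Rightarrow> 'k) \<Rightarrow> 'm) \<Rightarrow>
     ('x \<Rightarrow> 'v \<Rightarrow> 'v \<Rightarrow> ('m \<Rightarrow> 'k) \<Rightarrow> 'm) \<Rightarrow> bool" where
  "locally_compatible X V M \<gamma> \<beta> \<longleftrightarrow>
     (\<forall>x\<in>points X. \<exists>U e. openin (topo X) U \<and> x \<in> U \<and> local_frame X M U 1 (\<lambda>_. e) \<and>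
        (\<forall>y\<in>U. \<exists>g b.
           (\<forall>u\<in>fib V y. \<forall>v\<in>fib V y. \<forall>w\<in>fib V y.
              \<gamma> y u v w = scl (tensor_cube X M) (g u v w)
                (pure_tensor X M (tensor_square X M) y (e y) (pure_tensor X M M y (e y) (e y)))) \<and>
           (\<forall>u\<in>fib V y. \<forall>v\<in>fib V y.
              \<beta> y u v = scl (tensor_square X M) (b u v) (pure_tensor X M M y (e y) (e y))) \<and>
           compatible (scl V) (fib V y) g b))"

definition gamma_isotropic_line_subbundle ::
  "('x, 'k::field) fun_space \<Rightarrow> ('x, 'k, 'v::ab_group_add) vbundle \<Rightarrow>
     ('x \<Rightarrow> 'v \<Rightarrow> 'v \<Rightarrow> 'v \<Rightarrow> 'w::zero) \<Rightarrow> ('x \<Rightarrow> 'v set) \<Rightarrow> bool" where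
  "gamma_isotropic_line_subbundle X V \<gamma> F \<longleftrightarrow>
     subbundle X V 1 F \<and>
     (\<forall>x\<in>points X. gamma_isotropic_line (scl V) (fib V x) (\<gamma> x) (F x))"

definition beta_isotropic ::
  "('x, 'k) fun_space \<Rightarrow> ('x \<Rightarrow> 'v \<Rightarrow> 'v \<Rightarrow> 'w::zero) \<Rightarrow> ('x \<Rightarrow> 'v set) \<Rightarrow> bool" where
  "beta_isotropic X \<beta> F \<longleftrightarrow> (\<forall>x\<in>points X. \<forall>u\<in>F x. \<forall>v\<in>F x. \<beta> x u v = 0)"

text \<open>
  The morphism \<open>V \<rightarrow> F\<^sup>* \<otimes> V\<^sup>* \<otimes> L = Hom(F, Hom(V, L))\<close> given by \<open>v \<mapsto> (f \<mapsto> (w \<mapsto> \<gamma>(f, v, w)))\<close>.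
\<close>

definition contraction ::
  "('x, 'k, 'v::ab_group_add) vbundle \<Rightarrow> ('x \<Rightarrow> 'v \<Rightarrow> 'v \<Rightarrow> 'v \<Rightarrow> 'w::ab_group_add) \<Rightarrow>
     ('x \<Rightarrow> 'v set) \<Rightarrow> 'x \<Rightarrow> 'v \<Rightarrow> 'v \<Rightarrow> 'v \<Rightarrow> 'w" where
  "contraction V \<gamma> F x v =
     (if v \<in> fib V x
      then (\<lambda>f. if f \<in> F x then (\<lambda>w. if w \<in> fib V x then \<gamma> x f v w else 0) else 0)
      else 0)"

definition kernel ::
  "('x, 'k, 'v) vbundle \<Rightarrow> ('x \<Rightarrow> 'v \<Rightarrow> 'w::zero) \<Rightarrow> 'x \<Rightarrow> 'v set" where
  "kernel E h x = {v \<in> fib E x. h x v = 0}"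

end

theory Submission
  imports Defs "HOL-Combinatorics.Transposition"
begin

text \<open>
  \<^bold>\<open>On a fiber.\<close>  Trivialize \<open>M\<close> at a point, so that the two forms become a scalar trilinear form
  \<open>g\<close> and a scalar bilinear form \<open>b\<close> on the fiber \<open>A\<close> of \<open>V\<close>.  Define a cross product by
  \<open>b(u \<times> v, w) = g(u, v, w)\<close>.  Compatibility says that
  \<open>2 b(u \<times> v, u \<times> v) = b(u, u) b(v, v) - b(u, v)\<^sup>2\<close>.  As \<open>u \<times> _\<close> is skew-adjoint for \<open>b\<close> and \<open>2\<close> is
  invertible, polarizing in \<open>v\<close> gives \<open>2 u \<times> (u \<times> v) = b(u, v) u - b(u, u) v\<close> (\<open>double_cross\<close>);
  everything else is read off from this identity, as in the algebra of imaginary octonions.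

  Let \<open>f\<close> span the isotropic line.  There is \<open>p\<close>, independent of \<open>f\<close>, with \<open>f \<times> p = 0\<close>, and the
  identity yields \<open>b(f, f) = 0\<close>.  Let \<open>K\<close> be the kernel of \<open>f \<times> _\<close>, which is the fiber of the bundle
  in question.  For \<open>v \<in> K\<close> the identity for \<open>f, v\<close> reads \<open>b(f, v) f = 0\<close>, and then the one for
  \<open>v, f\<close> reads \<open>b(v, v) f = 0\<close>; hence \<open>K\<close> is \<open>b\<close>-isotropic (\<open>K_isotropic\<close>) and contained in the
  hyperplane \<open>f\<^sup>\<bottom>\<close>.  On this hyperplane \<open>f \<times> _\<close> has square zero, and the polarized identity shows that
  it maps the hyperplane onto \<open>K\<close>.  Its kernel there is \<open>K\<close> too, so \<open>6 = 2 dim K\<close> (\<open>dim_K\<close>).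

  \<^bold>\<open>In families.\<close>  Over a small open set, choose a regular generator \<open>f\<close> of the line bundle.  Then the
  kernel is cut out by the functionals \<open>v \<mapsto> g(f, v, w)\<close> for the regular sections \<open>w\<close> of \<open>V\<close>, which
  are regular sections of the dual bundle.  A family of subspaces of constant dimension that is locally
  the common kernel of regular functionals is a subbundle (\<open>subbundle_of_constant_rank_kernel\<close>): as
  long as one of the functionals does not vanish on the fiber over the given point, it cuts the rank of
  the current local frame down by one (\<open>local_frame_hyperplane\<close>); once all of them vanish there, the
  frame spans the kernel over that point and, since dimensions are constant, over all points of the
  open set.
\<close>

section \<open>Linear maps on a finite-dimensional subspace\<close>

lemma linear_map_on_0:
  assumes "vector_space s" "vector_space t" "0 \<in> A" "linear_map_on s t A C h"
  shows "h 0 = 0"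
proof -
  interpret vector_space_pair s t
    using assms(1,2) by (simp add: vector_space_pair_def)
  have "h (s 0 0) = t 0 (h 0)"
    using assms(3,4) unfolding linear_map_on_def by blast
  then show ?thesis
    by (simp add: vs1.scale_zero_left vs2.scale_zero_left)
qed

text \<open>
  Makes the library on globally linear maps applicable to maps that are linear only on a subspace.
\<close>

lemma linear_map_on_extend:
  assumes "vector_space s" "vector_space t" "module.subspace s A" "linear_map_on s t A C h"
  obtains h' where "Vector_Spaces.linear s t h'" "\<And>v. v \<in> A \<Longrightarrow> h' v = h v"
proof -
  interpret vector_space_pair s t
    using assms(1,2) by (simp add: vector_space_pair_def)
  obtain B where B: "B \<subseteq> A" "vs1.independent B" "A \<subseteq> vs1.span B"
    by (rule vs1.maximal_independent_subset)
  define h' where "h' = construct B h"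
  have lin: "Vector_Spaces.linear s t h'"
    unfolding h'_def using B(2) by (rule linear_construct)
  have AS: "vs1.span B = A"
    using B assms(3) by (simp add: subset_antisym vs1.span_minimal)
  have "v \<in> A \<and> h' v = h v" if "v \<in> vs1.span B" for v
    using that
  proof (induction rule: vs1.span_induct_alt)
    case base
    have "h 0 = 0"
      using assms by (intro linear_map_on_0) (auto simp: vs1.subspace_0)
    then show ?case
      using assms(3) linear_0[OF lin] by (simp add: vs1.subspace_0)
  next
    case (step c x y)
    have "x \<in> A" "h' x = h x"
      using step(1) B(1,2) by (auto simp: h'_def construct_basis)
    moreover from this have "s c x \<in> A"
      using assms(3) vs1.subspace_scale by blast
    ultimately show ?case
      using step assms(3,4) vs1.subspace_add
      by (simp add: linear_map_on_def linear_add[OF lin] linear_scale[OF lin])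
  qed
  with AS lin show thesis
    by (auto intro!: that[of h'])
qed

lemma linear_map_on_sum:
  assumes "vector_space s" "vector_space t" "module.subspace s A" "linear_map_on s t A C h"
    and "\<And>i. i \<in> I \<Longrightarrow> v i \<in> A"
  shows "h (\<Sum>i\<in>I. s (c i) (v i)) = (\<Sum>i\<in>I. t (c i) (h (v i)))"
proof -
  interpret vector_space_pair s t
    using assms(1,2) by (simp add: vector_space_pair_def)
  obtain h' where lin: "Vector_Spaces.linear s t h'" and h': "\<And>v. v \<in> A \<Longrightarrow> h' v = h v"
    using assms linear_map_on_extend by blast
  have "(\<Sum>i\<in>I. s (c i) (v i)) \<in> A"
    using assms(3,5) by (intro vs1.subspace_sum) (auto intro: vs1.subspace_scale)
  then have "h (\<Sum>i\<in>I. s (c i) (v i)) = h' (\<Sum>i\<in>I. s (c i) (v i))"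
    by (simp add: h')
  also have "\<dots> = (\<Sum>i\<in>I. t (c i) (h (v i)))"
    using assms(5) by (simp add: linear_sum[OF lin] linear_scale[OF lin] h')
  finally show ?thesis .
qed

text \<open>
  A basis of the kernel is extended to a basis of the whole space; the images of the added vectors
  form a basis of the image.
\<close>

lemma rank_nullity_on:
  assumes "vector_space s" "vector_space t" "linear_map_on s t A C h"
    and A: "module.subspace s A" and "finite D" "A \<subseteq> module.span s D"
  shows "vector_space.dim s A = vector_space.dim s {v \<in> A. h v = 0} + vector_space.dim t (h ` A)"
proof -
  interpret vector_space_pair s t
    using assms(1,2) by (simp add: vector_space_pair_def)
  obtain h' where lin: "Vector_Spaces.linear s t h'" and h': "\<And>v. v \<in> A \<Longrightarrow> h' v = h v"
    using assms linear_map_on_extend by blast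
  define N where "N = {v \<in> A. h' v = 0}"
  have N: "vs1.subspace N"
    unfolding N_def vs1.subspace_def
    using A by (simp add: vs1.subspace_def linear_add[OF lin] linear_scale[OF lin] linear_0[OF lin])
  obtain B where B: "B \<subseteq> N" "vs1.independent B" "N \<subseteq> vs1.span B"
    by (rule vs1.maximal_independent_subset)
  have BN: "vs1.span B = N"
    using B N by (simp add: subset_antisym vs1.span_minimal)
  obtain B' where B': "B \<subseteq> B'" "B' \<subseteq> A" "vs1.independent B'" "A \<subseteq> vs1.span B'"
    using vs1.maximal_independent_subset_extend[of B A] B by (auto simp: N_def)
  have BA: "vs1.span B' = A"
    using B' A by (simp add: subset_antisym vs1.span_minimal)
  have fin: "finite B'"
    using vs1.independent_span_bound[OF assms(5) B'(3)] B'(2) assms(6) by blast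
  have zero: "v = 0" if "v \<in> vs1.span (B' - B)" "h' v = 0" for v
  proof -
    have v: "v \<in> vs1.span (B' - B)" "v \<in> vs1.span B" "v \<in> vs1.span B'"
      using that BA BN vs1.span_mono[of "B' - B" B'] by (auto simp: N_def)
    have "vs1.representation B' v = vs1.representation (B' - B) v"
      using v B'(3) by (intro vs1.representation_extend) auto
    moreover have "vs1.representation B' v = vs1.representation B v"
      using v B'(1,3) by (intro vs1.representation_extend) auto
    ultimately have "vs1.representation B' v b = 0" for b
      using vs1.representation_ne_zero[of "B' - B" v b] vs1.representation_ne_zero[of B v b]
      by auto
    then show ?thesis
      using vs1.sum_nonzero_representation_eq[OF B'(3) v(3)] by simp
  qed
  have inj: "inj_on h' (vs1.span (B' - B))"
    using zero linear_inj_on_iff_eq_0[OF lin vs1.subspace_span] by blast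
  have ind: "vs2.independent (h' ` (B' - B))"
    using linear_independent_injective_image[OF lin _ inj] B'(3) vs1.independent_mono by blast
  have img: "h ` A = h' ` A"
    using h' by simp
  have "h' ` A \<subseteq> vs2.span (h' ` (B' - B))"
  proof -
    have "h' ` A \<subseteq> vs2.span (h' ` B')"
      using linear_spans_image[OF lin B'(4)] .
    also have "\<dots> \<subseteq> vs2.span (insert 0 (h' ` (B' - B)))"
      using B(1) by (intro vs2.span_mono) (auto simp: N_def)
    finally show ?thesis by simp
  qed
  then have "vs2.dim (h' ` A) = card (h' ` (B' - B))"
    using B'(2) ind by (intro vs2.dim_unique) auto
  also have "\<dots> = card (B' - B)"
    using inj vs1.span_superset[of "B' - B"] by (intro card_image) (rule inj_on_subset)
  also have "\<dots> = card B' - card B"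
    using fin B'(1) by (simp add: card_Diff_subset finite_subset)
  finally have "vs2.dim (h ` A) = card B' - card B"
    by (simp add: img)
  moreover have "{v \<in> A. h v = 0} = N"
    using h' by (auto simp: N_def)
  ultimately show ?thesis
    using BA BN B'(1,3) B(2) fin
    by (metis card_mono le_add_diff_inverse vs1.dim_span_eq_card_independent)
qed

lemma subspace_eq_of_dim_eq:
  assumes "vector_space s" "module.subspace s S" "S \<subseteq> A"
    and "finite D" "A \<subseteq> module.span s D" "vector_space.dim s S = vector_space.dim s A"
  shows "S = A"
proof -
  interpret vector_space s by fact
  obtain B where B: "B \<subseteq> S" "independent B" "S \<subseteq> span B" "card B = dim S"
    by (rule basis_exists)
  obtain B' where B': "B \<subseteq> B'" "B' \<subseteq> A" "independent B'" "A \<subseteq> span B'"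
    using maximal_independent_subset_extend[of B A] B assms(3) by blast
  have "finite B'"
    using independent_span_bound[OF assms(4) B'(3)] B'(2) assms(5) by blast
  moreover have "card B' = dim A"
    using B' by (simp add: basis_card_eq_dim)
  ultimately have "B = B'"
    using B'(1) B(4) assms(6) by (simp add: card_subset_eq)
  then show ?thesis
    using B B' assms(2,3) span_minimal[of B S] by blast
qed

lemma dim_hyperplane:
  fixes \<xi> :: "'v::ab_group_add \<Rightarrow> 'k::field"
  assumes "vector_space s" "linear_map_on s (*) A UNIV \<xi>"
    and A: "module.subspace s A" and "finite D" "A \<subseteq> module.span s D"
    and "v \<in> A" "\<xi> v \<noteq> 0"
  shows "vector_space.dim s A = Suc (vector_space.dim s {v \<in> A. \<xi> v = 0})"
proof -
  interpret vector_space s by fact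
  interpret K: vector_space "(*) :: 'k \<Rightarrow> 'k \<Rightarrow> 'k"
    by unfold_locales (auto simp: algebra_simps)
  have "c \<in> \<xi> ` A" for c
  proof (rule image_eqI)
    show "s (c / \<xi> v) v \<in> A"
      using A assms(6) by (simp add: subspace_scale)
    show "c = \<xi> (s (c / \<xi> v) v)"
      using assms(2,6,7) by (simp add: linear_map_on_def)
  qed
  then have "\<xi> ` A = UNIV" by blast
  moreover have "K.dim (UNIV :: 'k set) = 1"
    using K.scale_one
    by (intro K.dim_unique[of "{1}"]) (auto simp: K.span_singleton intro: K.scale_one[symmetric])
  ultimately show ?thesis
    using rank_nullity_on[OF assms(1) K.vector_space_axioms assms(2-5)] by simp
qed

section \<open>The cross product of a pair of compatible forms\<close>

text \<open>
  A nondegenerate form identifies a finite-dimensional space with its dual.  To see that every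
  functional is represented, compose \<open>v \<mapsto> b v\<close> with the map sending a functional to the vector whose
  coordinates are its values on a basis.  The result is an injective endomorphism \<open>T\<close> of \<open>A\<close>, hence
  surjective by counting dimensions.
\<close>

lemma dagger_represents:
  fixes b :: "'v::ab_group_add \<Rightarrow> 'v \<Rightarrow> 'k::field"
  assumes "vector_space s" and A: "module.subspace s A" and D: "finite D" "A \<subseteq> module.span s D"
    and b: "symmetric_bilinear s (*) A UNIV b" "nondegenerate A b"
    and xi: "linear_map_on s (*) A UNIV \<xi>"
  shows "dagger A b \<xi> \<in> A" and "\<And>w. w \<in> A \<Longrightarrow> b (dagger A b \<xi>) w = \<xi> w"
proof -
  interpret vector_space s by fact
  have K: "vector_space ((*) :: 'k \<Rightarrow> 'k \<Rightarrow> 'k)"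
    by unfold_locales (auto simp: algebra_simps)
  obtain B where B: "B \<subseteq> A" "independent B" "A \<subseteq> span B"
    by (rule maximal_independent_subset)
  have fin: "finite B"
    using independent_span_bound[OF D(1) B(2)] B(1) D(2) by blast
  have inj: "(\<Sum>e\<in>B. s (p e) e) = (\<Sum>e\<in>B. s (q e) e) \<Longrightarrow> e \<in> B \<Longrightarrow> p e = q e" for p q e
    using independentD[OF B(2) fin subset_refl, of "\<lambda>e. p e - q e"]
    by (simp add: scale_left_diff_distrib sum_subtractf)
  have eq_on: "h w = h' w"
    if "linear_map_on s (*) A UNIV h" "linear_map_on s (*) A UNIV h'"
      "\<And>e. e \<in> B \<Longrightarrow> h e = h' e" "w \<in> A" for h h' :: "'v \<Rightarrow> 'k" and w
  proof -
    have "w \<in> span B" using B(3) that(4) by blast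
    then have "w \<in> A \<and> h w = h' w"
    proof (induction rule: span_induct_alt)
      case base
      show ?case
        using linear_map_on_0[OF assms(1) K subspace_0[OF A] that(1)]
          linear_map_on_0[OF assms(1) K subspace_0[OF A] that(2)] A by (simp add: subspace_0)
    next
      case (step c x y)
      moreover have "x \<in> A" "s c x \<in> A"
        using B(1) step(1) A by (auto simp: subspace_scale)
      ultimately show ?case
        using that(1-3) A by (simp add: linear_map_on_def subspace_add)
    qed
    then show ?thesis ..
  qed
  define T where "T v = (\<Sum>e\<in>B. s (b v e) e)" for v
  have TA: "T v \<in> A" for v
    unfolding T_def using B(1) A by (intro subspace_sum) (auto simp: subspace_scale)
  have bl: "linear_map_on s (*) A UNIV (b u)" if "u \<in> A" for u
    using b(1) that by (simp add: symmetric_bilinear_def)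
  have T: "linear_map_on s s A A T"
    using b(1) B(1) TA
    by (auto simp: linear_map_on_def T_def symmetric_bilinear_def scale_left_distrib
        scale_sum_right sum.distrib subset_iff)
  have "v = 0" if "v \<in> A" "T v = 0" for v
  proof -
    have "b v e = 0" if "e \<in> B" for e
      using inj[of "b v" "\<lambda>_. 0"] that \<open>T v = 0\<close> by (simp add: T_def)
    moreover have "linear_map_on s (*) A UNIV (\<lambda>_. 0 :: 'k)"
      by (simp add: linear_map_on_def)
    ultimately have "\<forall>w\<in>A. b v w = 0"
      using eq_on[OF bl[OF \<open>v \<in> A\<close>]] by blast
    then show ?thesis
      using b(2) \<open>v \<in> A\<close> by (simp add: nondegenerate_def)
  qed
  moreover have "T 0 = 0"
    using linear_map_on_0[OF assms(1,1) subspace_0[OF A] T] .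
  ultimately have "{v \<in> A. T v = 0} = {0}"
    using A subspace_0 by auto
  moreover have "dim {0} = 0"
    using dim_unique[of "{}" "{0}" 0] by (simp add: independent_empty)
  ultimately have "dim (T ` A) = dim A"
    using rank_nullity_on[OF assms(1,1) T A D] by simp
  moreover have "subspace (T ` A)"
  proof -
    obtain T' where T': "Vector_Spaces.linear s s T'" "\<And>v. v \<in> A \<Longrightarrow> T' v = T v"
      using linear_map_on_extend[OF assms(1,1) A T] by blast
    have "T ` A = T' ` A" using T'(2) by simp
    then show ?thesis
      using Vector_Spaces.linear.axioms(3)[OF T'(1)] A module_hom.subspace_image by metis
  qed
  ultimately have "T ` A = A"
    using TA by (intro subspace_eq_of_dim_eq[OF assms(1) _ _ D]) auto
  moreover have "(\<Sum>e\<in>B. s (\<xi> e) e) \<in> A"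
    using B(1) A by (intro subspace_sum) (auto simp: subspace_scale)
  ultimately obtain v where v: "v \<in> A" "T v = (\<Sum>e\<in>B. s (\<xi> e) e)"
    by (metis imageE)
  have "b v e = \<xi> e" if "e \<in> B" for e
    using v(2) that unfolding T_def by (rule inj)
  then have rep: "\<forall>w\<in>A. b v w = \<xi> w"
    using eq_on[OF bl[OF v(1)] xi] by blast
  have uniq: "v' = v" if "v' \<in> A" and v': "\<forall>w\<in>A. b v' w = \<xi> w" for v'
  proof -
    have "v' - v \<in> A" using A that(1) v(1) by (rule subspace_diff)
    moreover have "b (v' - v) w = 0" if w: "w \<in> A" for w
    proof -
      have "\<forall>u\<in>A. linear_map_on s (*) A UNIV (\<lambda>x. b x u)"
        using b(1) unfolding symmetric_bilinear_def by (elim conjE)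
      from bspec[OF this w] have "b ((v' - v) + v) w = b (v' - v) w + b v w"
        using \<open>v' - v \<in> A\<close> v(1) unfolding linear_map_on_def by blast
      then show ?thesis
        using rep v' w by auto
    qed
    ultimately have "v' - v = 0" using b(2) unfolding nondegenerate_def by blast
    then show ?thesis by simp
  qed
  have "dagger A b \<xi> = v"
    unfolding dagger_def
  proof (rule the_equality)
    show "v \<in> A \<and> (\<forall>w\<in>A. b v w = \<xi> w)"
      using v(1) rep by (rule conjI)
  qed (erule conjE, rule uniq)
  then show "dagger A b \<xi> \<in> A" "\<And>w. w \<in> A \<Longrightarrow> b (dagger A b \<xi>) w = \<xi> w"
    using v(1) rep by simp_all
qed

text \<open>
  The ambient vector space may have infinite dimension; the finite spanning set \<open>D\<close> is only there to
  make \<open>A\<close> finite-dimensional.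
\<close>

locale compatible_forms = vector_space s
  for s :: "'k::field \<Rightarrow> 'v::ab_group_add \<Rightarrow> 'v" (infixr "*s" 75) +
  fixes A D :: "'v set" and g :: "'v \<Rightarrow> 'v \<Rightarrow> 'v \<Rightarrow> 'k" and b :: "'v \<Rightarrow> 'v \<Rightarrow> 'k"
  assumes subspace_A: "subspace A" and finite_D: "finite D" and A_span: "A \<subseteq> span D"
    and compat: "compatible (*s) A g b" and two: "(2::'k) \<noteq> 0"
begin

definition cross :: "'v \<Rightarrow> 'v \<Rightarrow> 'v" (infixl "\<times>\<times>" 78)
  where "u \<times>\<times> v = dagger A b (\<lambda>w. g u v w)"

lemma A_closed [simp, intro]:
  "0 \<in> A" "u \<in> A \<Longrightarrow> v \<in> A \<Longrightarrow> u + v \<in> A" "u \<in> A \<Longrightarrow> v \<in> A \<Longrightarrow> u - v \<in> A" "u \<in> A \<Longrightarrow> c *s u \<in> A"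
  "u \<in> A \<Longrightarrow> - u \<in> A"
  using subspace_A by (auto simp: subspace_0 subspace_add subspace_diff subspace_scale subspace_neg)

lemma b_scale: "u \<in> A \<Longrightarrow> v \<in> A \<Longrightarrow> b u (c *s v) = c * b u v"
    "u \<in> A \<Longrightarrow> v \<in> A \<Longrightarrow> b (c *s v) u = c * b v u"
  using compat by (auto simp: compatible_def symmetric_bilinear_def linear_map_on_def)

lemma b_add:
  assumes "u \<in> A" "v \<in> A" "w \<in> A"
  shows "b u (v + w) = b u v + b u w" "b (v + w) u = b v u + b w u"
  using compat assms by (auto simp: compatible_def symmetric_bilinear_def linear_map_on_def)

lemma b_diff:
  assumes "u \<in> A" "v \<in> A" "w \<in> A"
  shows "b u (v - w) = b u v - b u w" "b (v - w) u = b v u - b w u"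
  using b_add[of u "v - w" w] assms by (auto simp: eq_diff_eq)

lemmas b_bilinear = b_add b_diff b_scale

lemma b_sym: "u \<in> A \<Longrightarrow> v \<in> A \<Longrightarrow> b u v = b v u"
  using compat by (auto simp: compatible_def symmetric_bilinear_def)

lemma b_zero: "u \<in> A \<Longrightarrow> b 0 u = 0" "u \<in> A \<Longrightarrow> b u 0 = 0"
  using b_diff[of u 0 0] by simp_all

lemma b_eqI:
  assumes "u \<in> A" "v \<in> A" "\<And>w. w \<in> A \<Longrightarrow> b u w = b v w"
  shows "u = v"
proof -
  have "\<forall>w\<in>A. b (u - v) w = 0"
    using assms by (simp add: b_bilinear)
  then have "u - v = 0"
    using compat assms(1,2) unfolding compatible_def nondegenerate_def by blast
  then show ?thesis by simp
qed

lemma g_add: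
  assumes "u \<in> A" "v \<in> A" "w \<in> A" "x \<in> A"
  shows "g (u + x) v w = g u v w + g x v w" "g u (v + x) w = g u v w + g u x w"
    "g u v (w + x) = g u v w + g u v x"
  using assms compat by (auto simp: compatible_def alternating_trilinear_def linear_map_on_def)

lemma g_scale:
  assumes "u \<in> A" "v \<in> A" "w \<in> A"
  shows "g (c *s u) v w = c * g u v w" "g u (c *s v) w = c * g u v w"
    "g u v (c *s w) = c * g u v w"
  using assms compat by (auto simp: compatible_def alternating_trilinear_def linear_map_on_def)

lemmas g_trilinear = g_add g_scale

lemma g_alt: "u \<in> A \<Longrightarrow> v \<in> A \<Longrightarrow> g u u v = 0" "u \<in> A \<Longrightarrow> v \<in> A \<Longrightarrow> g u v u = 0"
    "u \<in> A \<Longrightarrow> v \<in> A \<Longrightarrow> g v u u = 0"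
  using compat by (auto simp: compatible_def alternating_trilinear_def)

lemma g_swap:
  assumes "u \<in> A" "v \<in> A" "w \<in> A"
  shows "g v u w = - g u v w" "g u w v = - g u v w"
proof -
  have "g (u + v) (u + v) w = g u u w + g u v w + (g v u w + g v v w)"
    using assms by (simp add: g_trilinear)
  then have "g u v w + g v u w = 0"
    using assms g_alt(1)[of "u + v" w] by (simp add: g_alt)
  then show "g v u w = - g u v w"
    by (simp add: eq_neg_iff_add_eq_0 add.commute)
  have "g u (v + w) (v + w) = g u v v + g u v w + (g u w v + g u w w)"
    using assms by (simp add: g_trilinear algebra_simps)
  then have "g u v w + g u w v = 0"
    using assms g_alt(3)[of "v + w" u] by (simp add: g_alt)
  then show "g u w v = - g u v w"
    by (simp add: eq_neg_iff_add_eq_0 add.commute)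
qed

lemma cross_in [simp, intro]: "u \<in> A \<Longrightarrow> v \<in> A \<Longrightarrow> u \<times>\<times> v \<in> A"
  and b_cross: "u \<in> A \<Longrightarrow> v \<in> A \<Longrightarrow> w \<in> A \<Longrightarrow> b (u \<times>\<times> v) w = g u v w"
proof -
  assume uv: "u \<in> A" "v \<in> A"
  have "symmetric_bilinear (*s) (*) A UNIV b" "nondegenerate A b"
    "linear_map_on (*s) (*) A UNIV (\<lambda>w. g u v w)"
    using compat uv by (auto simp: compatible_def alternating_trilinear_def)
  note * = dagger_represents[OF vector_space_axioms subspace_A finite_D A_span this]
  show "u \<times>\<times> v \<in> A" unfolding cross_def by (rule *(1))
  show "w \<in> A \<Longrightarrow> b (u \<times>\<times> v) w = g u v w" unfolding cross_def by (rule *(2))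
qed

lemma cross_add:
  assumes "u \<in> A" "v \<in> A" "w \<in> A"
  shows "u \<times>\<times> (v + w) = u \<times>\<times> v + u \<times>\<times> w" "(v + w) \<times>\<times> u = v \<times>\<times> u + w \<times>\<times> u"
  using assms by (intro b_eqI; simp add: b_cross b_add g_add)+

lemma cross_diff:
  assumes "u \<in> A" "v \<in> A" "w \<in> A"
  shows "u \<times>\<times> (v - w) = u \<times>\<times> v - u \<times>\<times> w"
  using cross_add(1)[of u "v - w" w] assms by (simp add: eq_diff_eq)

lemma cross_scale:
  assumes "u \<in> A" "v \<in> A"
  shows "u \<times>\<times> (c *s v) = c *s (u \<times>\<times> v)" "(c *s v) \<times>\<times> u = c *s (v \<times>\<times> u)"
  using assms by (intro b_eqI; simp add: b_cross b_scale g_scale)+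

lemmas cross_bilinear = cross_add cross_scale

lemma cross_0:
  assumes "u \<in> A"
  shows "u \<times>\<times> 0 = 0" "0 \<times>\<times> u = 0"
  using cross_scale[of u 0 0] assms by simp_all

lemma cross_skew:
  assumes "u \<in> A" "v \<in> A"
  shows "v \<times>\<times> u = (- 1) *s (u \<times>\<times> v)"
proof (rule b_eqI)
  fix x assume "x \<in> A"
  then show "b (v \<times>\<times> u) x = b ((- 1) *s (u \<times>\<times> v)) x"
    using assms g_swap(1)[of u v x] b_scale(2)[of x "u \<times>\<times> v" "- 1"] by (simp add: b_cross)
qed (use assms in auto)

text \<open>Since \<open>g u v\<close> is the functional represented by \<open>u \<times>\<times> v\<close>.\<close>

lemma cross_eq_0_iff:
  assumes "u \<in> A" "v \<in> A"
  shows "u \<times>\<times> v = 0 \<longleftrightarrow> (\<forall>w\<in>A. g u v w = 0)"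
proof
  assume "u \<times>\<times> v = 0"
  then show "\<forall>w\<in>A. g u v w = 0"
    using b_cross[OF assms] by (simp add: b_zero)
next
  assume "\<forall>w\<in>A. g u v w = 0"
  then show "u \<times>\<times> v = 0"
    using assms by (intro b_eqI) (simp_all add: b_cross b_zero)
qed

lemma b_cross_skew: "u \<in> A \<Longrightarrow> v \<in> A \<Longrightarrow> w \<in> A \<Longrightarrow> b (u \<times>\<times> v) w = - b v (u \<times>\<times> w)"
  by (simp add: b_cross b_sym[of v] g_swap(2)[of u v w])

lemma cross_norm:
  "u \<in> A \<Longrightarrow> v \<in> A \<Longrightarrow> 2 * b (u \<times>\<times> v) (u \<times>\<times> v) = b u u * b v v - b u v * b u v"
  using compat b_cross[of u v "u \<times>\<times> v"]
  unfolding compatible_def cross_def[symmetric] power2_eq_square by simp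

text \<open>
  Both sides are symmetric bilinear in \<open>v, w\<close> and agree for \<open>v = w\<close> by \<open>cross_norm\<close>; as \<open>2\<close> is
  invertible, they agree.
\<close>

lemma cross_inner:
  assumes "u \<in> A" "v \<in> A" "w \<in> A"
  shows "2 * b (u \<times>\<times> v) (u \<times>\<times> w) = b u u * b v w - b u v * b u w"
proof -
  have "2 * b (u \<times>\<times> (v + w)) (u \<times>\<times> (v + w))
      = b u u * b (v + w) (v + w) - b u (v + w) * b u (v + w)"
    using assms by (intro cross_norm) auto
  then have "2 * (2 * b (u \<times>\<times> v) (u \<times>\<times> w)) = 2 * (b u u * b v w - b u v * b u w)"
    using assms cross_norm[of u v] cross_norm[of u w]
    by (simp add: cross_bilinear b_bilinear b_sym[of w v] b_sym[of "u \<times>\<times> w" "u \<times>\<times> v"]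
        algebra_simps)
  then show ?thesis
    using two by (metis mult_cancel_left)
qed

text \<open>
  Skew-adjointness moves one factor \<open>u\<close> of \<open>cross_inner\<close> to the other side; what results is tested
  against an arbitrary \<open>w\<close>.
\<close>

lemma double_cross:
  assumes "u \<in> A" "v \<in> A"
  shows "2 *s (u \<times>\<times> (u \<times>\<times> v)) = b u v *s u - b u u *s v"
proof (rule b_eqI)
  fix w assume w: "w \<in> A"
  have "b (2 *s (u \<times>\<times> (u \<times>\<times> v))) w = - (2 * b (u \<times>\<times> v) (u \<times>\<times> w))"
    using assms w by (simp add: b_bilinear b_cross_skew[of u "u \<times>\<times> v"])
  also have "\<dots> = b (b u v *s u - b u u *s v) w"
    using assms w by (simp add: cross_inner b_bilinear)
  finally show "b (2 *s (u \<times>\<times> (u \<times>\<times> v))) w = b (b u v *s u - b u u *s v) w" .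
qed (use assms in auto)

text \<open>The part of \<open>double_cross\<close> for \<open>u + v\<close> that is linear in \<open>u\<close> and in \<open>v\<close>.\<close>

lemma double_cross_polarized:
  assumes "u \<in> A" "v \<in> A" "w \<in> A"
  shows "2 *s (u \<times>\<times> (v \<times>\<times> w)) + 2 *s (v \<times>\<times> (u \<times>\<times> w)) = b u w *s v + b v w *s u - (2 * b u v) *s w"
proof -
  have "2 *s ((u + v) \<times>\<times> ((u + v) \<times>\<times> w)) = b (u + v) w *s (u + v) - b (u + v) (u + v) *s w"
    using assms by (intro double_cross) auto
  then show ?thesis
    using assms double_cross[of u w] double_cross[of v w]
    by (simp add: cross_bilinear b_bilinear b_sym[of v u] algebra_simps)
qed

end

text \<open>
  The vectors \<open>f\<close> and \<open>p\<close> span a plane on which all products vanish.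
\<close>

locale isotropic_vector = compatible_forms +
  fixes f p
  assumes f: "f \<in> A" "f \<noteq> 0" and p: "p \<in> A" "p \<notin> span {f}" "f \<times>\<times> p = 0"
begin

abbreviation "K \<equiv> {v \<in> A. f \<times>\<times> v = 0}"
abbreviation "f_perp \<equiv> {v \<in> A. b f v = 0}"

text \<open>
  Otherwise \<open>0 = 2 f \<times> (f \<times> p) = b(f, p) f - b(f, f) p\<close> would make \<open>p\<close> a multiple of \<open>f\<close>.
\<close>

lemma b_f_f: "b f f = 0"
proof (rule ccontr)
  assume nz: "b f f \<noteq> 0"
  have "b f f *s p = b f p *s f"
    using double_cross[OF f(1) p(1)] p(3) f(1) by (simp add: cross_0)
  then have "inverse (b f f) *s b f f *s p = inverse (b f f) *s b f p *s f"
    by simp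
  then have "p = (inverse (b f f) * b f p) *s f"
    using nz by simp
  then show False
    using p(2) by (metis insertI1 span_base span_scale)
qed

lemma K_subset_f_perp: "v \<in> K \<Longrightarrow> b f v = 0"
  using double_cross[of f v] f by (simp add: cross_0 b_f_f)

lemma subspace_K: "subspace K"
  using f(1) by (auto simp: subspace_def cross_0 cross_bilinear)

text \<open>
  For \<open>u \<in> K\<close> both \<open>u \<times> f\<close> and \<open>b(u, f)\<close> vanish, so \<open>0 = 2 u \<times> (u \<times> f) = - b(u, u) f\<close>.  The case of
  two vectors follows by polarization.
\<close>

lemma K_isotropic:
  assumes "v \<in> K" "w \<in> K"
  shows "b v w = 0"
proof -
  have norm: "b u u = 0" if u: "u \<in> K" for u
  proof -
    have "u \<times>\<times> f = 0"
      using u f(1) cross_skew[of f u] by simp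
    moreover have "u \<times>\<times> 0 = 0"
      using u by (simp add: cross_0)
    ultimately have "b u u *s f = 0"
      using double_cross[of u f] u f(1) K_subset_f_perp[OF u] by (simp add: b_sym[of u f])
    then show ?thesis using f(2) by simp
  qed
  have "v + w \<in> K"
    using subspace_K assms by (rule subspace_add)
  then have "2 * b v w = 0"
    using norm[of "v + w"] norm[of v] norm[of w] assms by (simp add: b_bilinear b_sym[of w v])
  then show ?thesis using two by simp
qed

text \<open>
  That \<open>f \<times> _\<close> maps the hyperplane into \<open>K\<close> is \<open>double_cross\<close>.  Conversely, given \<open>w \<in> K\<close>, pick \<open>v\<close>
  with \<open>b(f, v) \<noteq> 0\<close>.  The polarized identity for \<open>f, v, w\<close> expresses \<open>2 b(f, v) w\<close> by
  \<open>f \<times> (v \<times> w)\<close> and a multiple of \<open>f\<close>; here \<open>v \<times> w\<close> is orthogonal to \<open>f\<close> because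
  \<open>g(v, w, f)\<close> is, up to sign, \<open>b(f \<times> w, v) = 0\<close>, and \<open>f\<close> itself is a multiple of \<open>f \<times> (f \<times> v)\<close>.
\<close>

lemma cross_image_f_perp: "(\<lambda>v. f \<times>\<times> v) ` f_perp = K"
proof
  show "(\<lambda>v. f \<times>\<times> v) ` f_perp \<subseteq> K"
  proof clarsimp
    fix v assume v: "v \<in> A" "b f v = 0"
    have "2 *s (f \<times>\<times> (f \<times>\<times> v)) = 0"
      using double_cross[of f v] f(1) v by (simp add: b_f_f)
    then show "f \<times>\<times> v \<in> A \<and> f \<times>\<times> (f \<times>\<times> v) = 0"
      using two f(1) v(1) by auto
  qed
  obtain v where v: "v \<in> A" "b f v \<noteq> 0"
    using b_eqI[of f 0] f b_zero by auto
  have cross_f_perp: "b f (f \<times>\<times> u) = 0" if "u \<in> A" for u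
    using that f(1) b_cross[of f u f] b_sym[of f "f \<times>\<times> u"] g_alt(2) by simp
  show "K \<subseteq> (\<lambda>v. f \<times>\<times> v) ` f_perp"
  proof
    fix w assume w: "w \<in> K"
    have v_cross_0: "v \<times>\<times> (f \<times>\<times> w) = 0"
      using w v(1) by (simp add: cross_0)
    have "(2 * b f v) *s w = b v w *s f - 2 *s (f \<times>\<times> (v \<times>\<times> w))"
      using double_cross_polarized[of f v w] w v f(1) K_subset_f_perp[OF w] v_cross_0
      by (simp add: algebra_simps)
    then have "b f v *s (2 * b f v) *s w = b v w *s b f v *s f - (2 * b f v) *s (f \<times>\<times> (v \<times>\<times> w))"
      by (simp add: scale_right_diff_distrib ac_simps)
    also have "b f v *s f = 2 *s (f \<times>\<times> (f \<times>\<times> v))"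
      using double_cross[of f v] f(1) v b_f_f by simp
    also have "b v w *s 2 *s (f \<times>\<times> (f \<times>\<times> v)) - (2 * b f v) *s (f \<times>\<times> (v \<times>\<times> w)) =
        f \<times>\<times> ((b v w * 2) *s (f \<times>\<times> v) - (2 * b f v) *s (v \<times>\<times> w))"
      using f(1) v w by (simp add: cross_diff cross_scale)
    finally have *: "(b f v * (2 * b f v)) *s w
        = f \<times>\<times> ((b v w * 2) *s (f \<times>\<times> v) - (2 * b f v) *s (v \<times>\<times> w))"
      by simp
    \<comment> \<open>Dividing by the scalar in front of \<open>w\<close> gives the preimage \<open>z\<close>.\<close>
    define c where "c = b f v * (2 * b f v)"
    define z where "z = inverse c *s ((b v w * 2) *s (f \<times>\<times> v) - (2 * b f v) *s (v \<times>\<times> w))"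
    have "c \<noteq> 0"
      using two v(2) by (simp add: c_def)
    then have "w = inverse c *s c *s w"
      by simp
    also have "\<dots> = f \<times>\<times> z"
      unfolding z_def c_def * using f(1) v w by (intro cross_scale(1)[symmetric]) auto
    finally have "w = f \<times>\<times> z" .
    moreover have "b f z = 0"
    proof -
      have "g f w v = 0"
        using w f(1) v(1) cross_eq_0_iff[of f w] by auto
      then have "b f (v \<times>\<times> w) = 0"
        using f(1) v(1) w b_sym[of f "v \<times>\<times> w"] g_swap(1)[of f v w] g_swap(2)[of f v w]
          g_swap(2)[of v f w]
        by (simp add: b_cross)
      then show ?thesis
        using f(1) v(1) w by (simp add: z_def b_bilinear cross_f_perp)
    qed
    moreover have "z \<in> A"
      using f(1) v(1) w by (auto simp: z_def)
    ultimately show "w \<in> (\<lambda>v. f \<times>\<times> v) ` f_perp"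
      by blast
  qed
qed

text \<open>
  Rank and nullity of \<open>f \<times> _\<close> on the hyperplane orthogonal to \<open>f\<close>: kernel and image are both \<open>K\<close>.
\<close>

lemma dim_K: "dim A = Suc (2 * dim K)"
proof -
  obtain v where v: "v \<in> A" "b f v \<noteq> 0"
    using b_eqI[of f 0] f b_zero by auto
  have b: "linear_map_on (*s) (*) A UNIV (b f)"
    using f(1) by (simp add: linear_map_on_def b_bilinear)
  have lin: "linear_map_on (*s) (*s) f_perp A (\<lambda>v. f \<times>\<times> v)"
    using f(1) by (simp add: linear_map_on_def cross_bilinear)
  have "subspace f_perp"
    using f(1) by (auto simp: subspace_def b_zero b_bilinear)
  then have "dim f_perp = dim {v \<in> f_perp. f \<times>\<times> v = 0} + dim ((\<lambda>v. f \<times>\<times> v) ` f_perp)"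
    using rank_nullity_on[OF vector_space_axioms vector_space_axioms lin _ finite_D] A_span by auto
  moreover have "{v \<in> f_perp. f \<times>\<times> v = 0} = K"
    using K_subset_f_perp by auto
  ultimately show ?thesis
    using dim_hyperplane[OF vector_space_axioms b subspace_A finite_D A_span v]
    by (simp add: cross_image_f_perp)
qed

end

text \<open>
  What the two locales prove about a fiber, with the kernel of \<open>f \<times> _\<close> expressed by \<open>g\<close> again.
\<close>

lemma compatible_annihilator:
  fixes s :: "'k::field \<Rightarrow> 'v::ab_group_add \<Rightarrow> 'v"
  assumes "vector_space s" "module.subspace s A" "finite D" "A \<subseteq> module.span s D"
    and "vector_space.dim s A = 7" "compatible s A g b" "(2::'k) \<noteq> 0"
    and "f \<in> A" "f \<noteq> 0" "p \<in> A" "p \<notin> module.span s {f}" "\<forall>w\<in>A. g f p w = 0"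
  defines "K \<equiv> {v \<in> A. \<forall>w\<in>A. g f v w = 0}"
  shows "vector_space.dim s K = 3" "\<And>u v. u \<in> K \<Longrightarrow> v \<in> K \<Longrightarrow> b u v = 0"
proof -
  interpret compatible_forms s A D g b
    using assms(1-7) by (simp add: compatible_forms_def compatible_forms_axioms_def)
  interpret isotropic_vector s A D g b f p
    using assms(8-12) cross_eq_0_iff[of f p] by unfold_locales auto
  have K: "K = {v \<in> A. cross f v = 0}"
    using assms(8) cross_eq_0_iff[of f] by (auto simp: K_def)
  show "\<And>u v. u \<in> K \<Longrightarrow> v \<in> K \<Longrightarrow> b u v = 0"
    unfolding K by (rule K_isotropic)
  show "dim K = 3"
    using dim_K assms(5) by (simp add: K)
qed

section \<open>Frames and regular functions\<close>

lemma is_sheaf_cong: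
  assumes "is_sheaf T \<F>" "openin T U" "s \<in> \<F> U" "\<And>x. x \<in> U \<Longrightarrow> t x = s x"
  shows "t \<in> \<F> U"
proof -
  have "\<forall>U s t. openin T U \<longrightarrow> s \<in> \<F> U \<longrightarrow> (\<forall>x\<in>U. t x = s x) \<longrightarrow> t \<in> \<F> U"
    using assms(1) unfolding is_sheaf_def by (elim conjE)
  from this[rule_format, OF assms(2,3)] show ?thesis
    using assms(4) by simp
qed

lemma is_sheaf_restrict:
  assumes "is_sheaf T \<F>" "openin T U" "openin T W" "W \<subseteq> U" "s \<in> \<F> U"
  shows "s \<in> \<F> W"
proof -
  have "\<forall>U W s. openin T U \<longrightarrow> openin T W \<longrightarrow> W \<subseteq> U \<longrightarrow> s \<in> \<F> U \<longrightarrow> s \<in> \<F> W"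
    using assms(1) unfolding is_sheaf_def by (elim conjE)
  from this[rule_format, OF assms(2-5)] show ?thesis .
qed

lemma is_sheaf_glue:
  assumes "is_sheaf T \<F>" "openin T U"
    and "\<And>x. x \<in> U \<Longrightarrow> \<exists>W. openin T W \<and> x \<in> W \<and> W \<subseteq> U \<and> s \<in> \<F> W"
  shows "s \<in> \<F> U"
proof -
  have "\<forall>U s. openin T U \<longrightarrow>
      (\<forall>x\<in>U. \<exists>W. openin T W \<and> x \<in> W \<and> W \<subseteq> U \<and> s \<in> \<F> W) \<longrightarrow> s \<in> \<F> U"
    using assms(1) unfolding is_sheaf_def by (elim conjE)
  from this[rule_format, OF assms(2)] show ?thesis
    using assms(3) by simp
qed

lemma (in vector_space) sum_scale_delta:
  assumes "k < (n::nat)"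
  shows "(\<Sum>i<n. scale (if i = k then c else 0) (v i)) = scale c (v k)"
proof -
  have "(\<Sum>i<n. scale (if i = k then c else 0) (v i)) = (\<Sum>i<n. if i = k then scale c (v i) else 0)"
    by (intro sum.cong) auto
  then show ?thesis using assms by simp
qed

lemma (in vector_space) span_indexed:
  "span (v ` {..<n::nat}) = range (\<lambda>c. \<Sum>i<n. scale (c i) (v i))"
proof
  show "range (\<lambda>c. \<Sum>i<n. scale (c i) (v i)) \<subseteq> span (v ` {..<n})"
    by (clarify, intro span_sum span_scale span_base) auto
  have "u \<in> range (\<lambda>c. \<Sum>i<n. scale (c i) (v i))" if "u \<in> span (v ` {..<n})" for u
    using that
  proof (induction rule: span_induct_alt)
    case base
    show ?case by (rule range_eqI[of _ _ "\<lambda>_. 0"]) simp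
  next
    case (step c x y)
    then obtain k d where "k < n" "x = v k" and y: "y = (\<Sum>i<n. scale (d i) (v i))"
      by blast
    then have "scale c x = (\<Sum>i<n. scale (if i = k then c else 0) (v i))"
      by (simp add: sum_scale_delta)
    then have "scale c x + y = (\<Sum>i<n. scale ((if i = k then c else 0) + d i) (v i))"
      by (simp add: y scale_left_distrib sum.distrib)
    then show ?case
      by (rule range_eqI[of _ _ "\<lambda>i. (if i = k then c else 0) + d i"])
  qed
  then show "span (v ` {..<n}) \<subseteq> range (\<lambda>c. \<Sum>i<n. scale (c i) (v i))" by blast
qed

lemma (in vector_space) independent_indexed:
  "inj_on v {..<n::nat} \<and> independent (v ` {..<n}) \<longleftrightarrow>
     (\<forall>c. (\<Sum>i<n. scale (c i) (v i)) = 0 \<longrightarrow> (\<forall>i<n. c i = 0))" (is "_ \<longleftrightarrow> ?R")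
proof (intro iffI allI impI)
  fix c i assume v: "inj_on v {..<n} \<and> independent (v ` {..<n})"
    and c: "(\<Sum>i<n. scale (c i) (v i)) = 0" and i: "i < n"
  have "(\<Sum>x\<in>v ` {..<n}. scale (c (the_inv_into {..<n} v x)) x) = 0"
    using v c by (simp add: sum.reindex the_inv_into_f_f)
  then have "c (the_inv_into {..<n} v (v i)) = 0"
    using independentD[of "v ` {..<n}" "v ` {..<n}" "\<lambda>x. c (the_inv_into {..<n} v x)" "v i"] v i
    by auto
  then show "c i = 0"
    using v i by (simp add: the_inv_into_f_f)
next
  assume R: ?R
  have inj: "inj_on v {..<n}"
  proof (rule inj_onI, rule ccontr)
    fix i j assume ij: "i \<in> {..<n}" "j \<in> {..<n}" "v i = v j" "i \<noteq> j"
    define c where "c = (\<lambda>k. (if k = i then 1 else 0) - (if k = j then 1 else 0) :: 'a)"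
    have "(\<Sum>k<n. scale (c k) (v k)) = 0"
      using ij by (simp add: c_def scale_left_diff_distrib sum_subtractf sum_scale_delta)
    then have "c i = 0" using R ij(1) by blast
    then show False using ij(4) by (simp add: c_def)
  qed
  moreover have "independent (v ` {..<n})"
  proof (rule independent_if_scalars_zero)
    fix f x assume "(\<Sum>x\<in>v ` {..<n}. scale (f x) x) = 0" "x \<in> v ` {..<n}"
    then show "f x = 0"
      using R[rule_format, of "\<lambda>i. f (v i)"] inj by (auto simp: sum.reindex)
  qed simp
  ultimately show "inj_on v {..<n} \<and> independent (v ` {..<n})" ..
qed

text \<open>
  Coefficient families indexed by \<open>i < n\<close> describe frames better than sets of vectors: the
  constructions below change the coefficients and keep the index set.
\<close>

lemma local_frame_iff:
  assumes "vector_space (scl E)"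
  shows "local_frame X E U n e \<longleftrightarrow>
     (\<forall>x\<in>U. \<forall>c. (\<Sum>i<n. scl E (c i) (e i x)) = 0 \<longrightarrow> (\<forall>i<n. c i = 0)) \<and>
     (\<forall>x\<in>U. fib E x = range (\<lambda>c. \<Sum>i<n. scl E (c i) (e i x))) \<and>
     (\<forall>W f. openin (topo X) W \<longrightarrow> W \<subseteq> U \<longrightarrow>
        ((\<lambda>x. \<Sum>i<n. scl E (f i x) (e i x)) \<in> sec E W \<longleftrightarrow> (\<forall>i<n. f i \<in> reg X W)))"
proof -
  interpret vector_space "scl E" by fact
  show ?thesis
    unfolding local_frame_def span_indexed[where n = n]
      independent_indexed[where n = n, symmetric] by blast
qed

context
  fixes X :: "('x, 'k::field) fun_space"
  assumes X: "space_with_functions X"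
begin

lemma reg_sheaf: "is_sheaf (topo X) (reg X)"
  using X by (simp add: space_with_functions_def)

lemma reg_restrict:
  "openin (topo X) U \<Longrightarrow> openin (topo X) W \<Longrightarrow> W \<subseteq> U \<Longrightarrow> f \<in> reg X U \<Longrightarrow> f \<in> reg X W"
  by (rule is_sheaf_restrict[OF reg_sheaf])

lemma reg_const: "openin (topo X) U \<Longrightarrow> (\<lambda>_. c) \<in> reg X U"
  and reg_add: "openin (topo X) U \<Longrightarrow> f \<in> reg X U \<Longrightarrow> h \<in> reg X U \<Longrightarrow> (\<lambda>x. f x + h x) \<in> reg X U"
  and reg_mult: "openin (topo X) U \<Longrightarrow> f \<in> reg X U \<Longrightarrow> h \<in> reg X U \<Longrightarrow> (\<lambda>x. f x * h x) \<in> reg X U"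
  and open_nonzero: "openin (topo X) U \<Longrightarrow> f \<in> reg X U \<Longrightarrow> openin (topo X) {x \<in> U. f x \<noteq> 0}"
  using X unfolding space_with_functions_def by simp_all

lemma reg_inverse:
  assumes "openin (topo X) U" "f \<in> reg X U" "\<And>x. x \<in> U \<Longrightarrow> f x \<noteq> 0"
  shows "(\<lambda>x. inverse (f x)) \<in> reg X U"
proof -
  have "{x \<in> U. f x \<noteq> 0} = U" using assms(3) by auto
  moreover have "(\<lambda>x. inverse (f x)) \<in> reg X {x \<in> U. f x \<noteq> 0}"
    using X assms(1,2) unfolding space_with_functions_def by blast
  ultimately show ?thesis by simp
qed

lemma reg_sum:
  assumes "openin (topo X) U" "\<And>i. i \<in> I \<Longrightarrow> f i \<in> reg X U"
  shows "(\<lambda>x. \<Sum>i\<in>I. f i x) \<in> reg X U"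
  using assms(2)
proof (induction I rule: infinite_finite_induct)
  case (insert i I)
  then have "(\<lambda>x. f i x + (\<Sum>i\<in>I. f i x)) \<in> reg X U"
    using assms(1) by (intro reg_add) auto
  with insert show ?case by simp
qed (simp_all add: reg_const[OF assms(1)])

end

lemma local_frame_subset:
  assumes "local_frame X E U n e" "U' \<subseteq> U"
  shows "local_frame X E U' n e"
proof -
  have "x \<in> U" if "x \<in> U'" for x using assms(2) that by blast
  moreover have "W \<subseteq> U" if "W \<subseteq> U'" for W using assms(2) that by (rule order_trans[rotated])
  ultimately show ?thesis
    using assms(1) unfolding local_frame_def by simp
qed

lemma local_frame_sec_iff:
  assumes "local_frame X E U n e" "openin (topo X) W" "W \<subseteq> U"
  shows "(\<lambda>x. \<Sum>i<n. scl E (f i x) (e i x)) \<in> sec E W \<longleftrightarrow> (\<forall>i<n. f i \<in> reg X W)"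
  using assms unfolding local_frame_def by simp

lemma local_frame_fib:
  assumes "vector_space (scl E)" "local_frame X E U n e" "x \<in> U"
  shows "fib E x = range (\<lambda>c. \<Sum>i<n. scl E (c i) (e i x))"
  using assms(2,3) unfolding local_frame_iff[OF assms(1)] by simp

lemma local_frame_coeff_zero:
  assumes "vector_space (scl E)" "local_frame X E U n e" "x \<in> U"
    and "(\<Sum>i<n. scl E (c i) (e i x)) = 0" "i < n"
  shows "c i = 0"
  using assms(2-5) unfolding local_frame_iff[OF assms(1)] by simp

lemma local_frame_section:
  assumes X: "space_with_functions X" and U: "openin (topo X) U"
    and E: "vector_space (scl E)" and e: "local_frame X E U n e"
    and x: "x \<in> U" "v \<in> fib E x"
  obtains t where "t \<in> sec E U" "t x = v"
proof -
  obtain c where "v = (\<Sum>i<n. scl E (c i) (e i x))"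
    using local_frame_fib[OF E e x(1)] x(2) by blast
  moreover have "(\<lambda>x. \<Sum>i<n. scl E (c i) (e i x)) \<in> sec E U"
  proof -
    have "\<forall>i<n. (\<lambda>_. c i) \<in> reg X U"
      using reg_const[OF X U] by blast
    then show ?thesis
      using local_frame_sec_iff[OF e U] by simp
  qed
  ultimately show thesis using that by blast
qed

lemma local_frame_in_sec:
  assumes X: "space_with_functions X" and U: "openin (topo X) U"
    and E: "vector_space (scl E)" and e: "local_frame X E U n e" and "k < n"
  shows "e k \<in> sec E U"
proof -
  interpret vector_space "scl E" by fact
  have "\<forall>i<n. (\<lambda>_. if i = k then 1 else 0) \<in> reg X U"
    using reg_const[OF X U] by blast
  then have "(\<lambda>x. \<Sum>i<n. scl E (if i = k then 1 else 0) (e i x)) \<in> sec E U"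
    using local_frame_sec_iff[OF e U subset_refl, of "\<lambda>i _. if i = k then 1 else 0"] by simp
  then show ?thesis
    using \<open>k < n\<close> by (simp add: sum_scale_delta)
qed

text \<open>
  The coefficients \<open>f\<close> are only prescribed over \<open>W\<close>, whereas the definition of a frame speaks of the
  total function \<open>x \<mapsto> \<Sum>i. f i x * e i x\<close>; the two sections agree over \<open>W\<close>, which suffices in a sheaf.
\<close>

lemma local_frame_coeff_regular:
  assumes E: "vector_bundle X m E" and e: "local_frame X E U n e"
    and W: "openin (topo X) W" "W \<subseteq> U" and t: "t \<in> sec E W"
    and f: "\<And>x. x \<in> W \<Longrightarrow> t x = (\<Sum>i<n. scl E (f i x) (e i x))" and "k < n"
  shows "f k \<in> reg X W"
proof -
  have "is_sheaf (topo X) (sec E)"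
    using E by (simp add: vector_bundle_def)
  then have "(\<lambda>x. \<Sum>i<n. scl E (f i x) (e i x)) \<in> sec E W"
    using W(1) t by (rule is_sheaf_cong) (simp add: f)
  then show ?thesis
    using local_frame_sec_iff[OF e W] \<open>k < n\<close> by blast
qed

lemma local_frame_transpose:
  assumes E: "vector_space (scl E)" and e: "local_frame X E U n e" and jk: "j < n" "k < n"
  shows "local_frame X E U n (\<lambda>i. e (transpose j k i))"
proof -
  have lt: "transpose j k i < n \<longleftrightarrow> i < n" for i
    using jk by (auto simp: transpose_def)
  have all: "(\<forall>i<n. P (transpose j k i)) \<longleftrightarrow> (\<forall>i<n. P i)" for P
    using lt transpose_involutory[of j k] by metis
  have sum: "(\<Sum>i<n. scl E (h i) (e (transpose j k i) x)) =
      (\<Sum>i<n. scl E (h (transpose j k i)) (e i x))" for h x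
    by (rule sum.reindex_bij_witness[of _ "transpose j k" "transpose j k"]) (auto simp: lt)
  have range: "range (\<lambda>c. \<Sum>i<n. scl E (c (transpose j k i)) (e i x)) =
      range (\<lambda>c. \<Sum>i<n. scl E (c i) (e i x))" (is "?l = ?r") for x
  proof
    show "?r \<subseteq> ?l"
    proof clarify
      fix c
      show "(\<Sum>i<n. scl E (c i) (e i x)) \<in> ?l"
        by (rule range_eqI[of _ _ "\<lambda>i. c (transpose j k i)"]) simp
    qed
  qed auto
  show ?thesis
    unfolding local_frame_iff[OF E] sum range
  proof (intro conjI ballI allI impI)
    fix x c i assume "x \<in> U" "(\<Sum>i<n. scl E (c (transpose j k i)) (e i x)) = 0" "i < n"
    then have "\<forall>i<n. c (transpose j k i) = 0"
      using local_frame_coeff_zero[OF E e, of x "\<lambda>i. c (transpose j k i)"] by simp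
    then have "c (transpose j k (transpose j k i)) = 0"
      using lt[of i] \<open>i < n\<close> by blast
    then show "c i = 0" by simp
  next
    fix x assume "x \<in> U"
    then show "fib E x = range (\<lambda>c. \<Sum>i<n. scl E (c i) (e i x))"
      by (rule local_frame_fib[OF E e])
  next
    fix W f assume "openin (topo X) W" "W \<subseteq> U"
    then have "(\<lambda>x. \<Sum>i<n. scl E (f (transpose j k i) x) (e i x)) \<in> sec E W \<longleftrightarrow>
        (\<forall>i<n. f (transpose j k i) \<in> reg X W)"
      by (rule local_frame_sec_iff[OF e])
    then show "(\<lambda>x. \<Sum>i<n. scl E (f (transpose j k i) x) (e i x)) \<in> sec E W \<longleftrightarrow>
        (\<forall>i<n. f i \<in> reg X W)"
      by (simp only: all[of "\<lambda>i. f i \<in> reg X W"])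
  qed
qed

section \<open>Kernels of constant rank\<close>

lemma restrict_simps [simp]:
  "scl (restrict_vbundle E F) = scl E" "fib (restrict_vbundle E F) = F"
  "sec (restrict_vbundle E F) U = {t \<in> sec E U. \<forall>x\<in>U. t x \<in> F x}"
  by (simp_all add: restrict_vbundle_def)

lemma local_frame_restrict_cong:
  assumes "\<And>x. x \<in> U \<Longrightarrow> F x = G x"
  shows "local_frame X (restrict_vbundle E F) U n e \<longleftrightarrow> local_frame X (restrict_vbundle E G) U n e"
proof -
  have "{t \<in> sec E W. \<forall>x\<in>W. t x \<in> F x} = {t \<in> sec E W. \<forall>x\<in>W. t x \<in> G x}"
    if "W \<subseteq> U" for W
  proof (rule Collect_cong, rule conj_cong[OF refl], rule ball_cong[OF refl])
    fix t x assume "x \<in> W"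
    then show "t x \<in> F x \<longleftrightarrow> t x \<in> G x" using assms[of x] that by auto
  qed
  then show ?thesis
    unfolding local_frame_def restrict_simps using assms by (simp cong: imp_cong)
qed

lemma sec_dual_bundle:
  "sec (dual_bundle X E) U =
     {h. (\<forall>x\<in>U. linear_map_on (scl E) (*) (fib E x) UNIV (h x) \<and> (\<forall>v. v \<notin> fib E x \<longrightarrow> h x v = 0)) \<and>
         (\<forall>W s. openin (topo X) W \<longrightarrow> W \<subseteq> U \<longrightarrow> s \<in> sec E W \<longrightarrow> (\<lambda>x. h x (s x)) \<in> reg X W)}"
  by (simp add: dual_bundle_def hom_bundle_def structure_bundle_def)

text \<open>
  Elimination of one basis vector.  Subtracting a multiple of \<open>e n\<close> moves the other frame vectors into
  the kernel of \<open>\<xi>\<close>.  A combination of the new vectors with coefficients \<open>c\<close> is the combination of the old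
  ones whose coefficients are \<open>c\<close> and, at \<open>n\<close>, the number \<open>last c x\<close> that makes \<open>\<xi>\<close> vanish.  This
  number depends regularly on \<open>c\<close>, so each property of the new frame is inherited from the old one.
\<close>

lemma local_frame_hyperplane:
  fixes X :: "('x, 'k::field) fun_space" and E :: "('x, 'k, 'v::ab_group_add) vbundle"
  assumes X: "space_with_functions X" and U: "openin (topo X) U" and E: "vector_space (scl E)"
    and E_sub: "\<And>x. x \<in> U \<Longrightarrow> module.subspace (scl E) (fib E x)"
    and G: "\<And>x. x \<in> U \<Longrightarrow> G x \<subseteq> fib E x"
    and e: "local_frame X (restrict_vbundle E G) U (Suc n) e"
    and \<xi>: "\<xi> \<in> sec (dual_bundle X E) U" and nz: "\<And>x. x \<in> U \<Longrightarrow> \<xi> x (e n x) \<noteq> 0"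
  shows "local_frame X (restrict_vbundle E (\<lambda>x. {v \<in> G x. \<xi> x v = 0})) U n
           (\<lambda>i x. e i x - scl E (\<xi> x (e i x) / \<xi> x (e n x)) (e n x))" (is "local_frame X ?H U n ?e")
proof -
  interpret vector_space "scl E" by fact
  have K: "vector_space ((*) :: 'k \<Rightarrow> 'k \<Rightarrow> 'k)"
    by unfold_locales (auto simp: algebra_simps)
  have EG: "vector_space (scl (restrict_vbundle E G))" and EH: "vector_space (scl ?H)"
    using E by simp_all
  have eG: "e i x \<in> G x" and eE: "e i x \<in> fib E x" if "x \<in> U" "i < Suc n" for i x
  proof -
    have "e i \<in> sec (restrict_vbundle E G) U"
      using local_frame_in_sec[OF X U EG e that(2)] .
    then show "e i x \<in> G x" using that(1) by simp
    then show "e i x \<in> fib E x" using G that(1) by blast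
  qed
  have \<xi>_sum: "\<xi> x (\<Sum>i<Suc n. scl E (c i) (e i x)) = (\<Sum>i<Suc n. c i * \<xi> x (e i x))"
    if "x \<in> U" for x c
    using \<xi> that eE by (intro linear_map_on_sum[OF E K E_sub]) (auto simp: sec_dual_bundle)
  define last where "last c x = - (\<Sum>i<n. c i * \<xi> x (e i x)) * inverse (\<xi> x (e n x))" for c x
  have sum: "(\<Sum>i<n. scl E (c i) (?e i x)) =
      (\<Sum>i<Suc n. scl E (if i < n then c i else last c x) (e i x))" for c x
    by (simp add: last_def scale_right_diff_distrib sum_subtractf scale_sum_left sum_distrib_right
        divide_inverse mult.assoc)
  have \<xi>_zero: "\<xi> x (\<Sum>i<n. scl E (c i) (?e i x)) = 0" if "x \<in> U" for c x
    using nz[OF that] by (simp only: sum \<xi>_sum[OF that]) (simp add: last_def)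
  show ?thesis
    unfolding local_frame_iff[OF EH] restrict_simps
  proof (intro conjI ballI allI impI)
    fix x c i assume "x \<in> U" "(\<Sum>i<n. scl E (c i) (?e i x)) = 0" "i < n"
    then have "(if i < n then c i else last c x) = 0"
      using local_frame_coeff_zero[OF EG e, of x "\<lambda>i. if i < n then c i else last c x" i]
      by (simp only: sum restrict_simps less_SucI)
    then show "c i = 0" using \<open>i < n\<close> by simp
  next
    fix x assume x: "x \<in> U"
    then have Gx: "G x = range (\<lambda>c. \<Sum>i<Suc n. scl E (c i) (e i x))"
      using local_frame_fib[OF EG e] by simp
    show "{v \<in> G x. \<xi> x v = 0} = range (\<lambda>c. \<Sum>i<n. scl E (c i) (?e i x))"
    proof (intro equalityI subsetI)
      fix v assume "v \<in> {v \<in> G x. \<xi> x v = 0}"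
      then obtain c where v: "v = (\<Sum>i<Suc n. scl E (c i) (e i x))" "\<xi> x v = 0"
        unfolding Gx by blast
      then have "(\<Sum>i<n. c i * \<xi> x (e i x)) + c n * \<xi> x (e n x) = 0"
        using \<xi>_sum[OF x, of c] by simp
      then have "c n = last c x"
        using nz[OF x] by (simp add: last_def field_simps eq_neg_iff_add_eq_0)
      then have "v = (\<Sum>i<n. scl E (c i) (?e i x))"
        unfolding sum v by (intro sum.cong) (auto simp: less_Suc_eq)
      then show "v \<in> range (\<lambda>c. \<Sum>i<n. scl E (c i) (?e i x))" by blast
    next
      fix v assume "v \<in> range (\<lambda>c. \<Sum>i<n. scl E (c i) (?e i x))"
      then obtain c where "v = (\<Sum>i<n. scl E (c i) (?e i x))" by blast
      then show "v \<in> {v \<in> G x. \<xi> x v = 0}"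
        using \<xi>_zero[OF x, of c] unfolding Gx by (auto simp only: sum)
    qed
  next
    fix W f assume W: "openin (topo X) W" "W \<subseteq> U"
    define f' where "f' i x = (if i < n then f i x else last (\<lambda>i. f i x) x)" for i x
    have reg_\<xi>: "(\<lambda>x. \<xi> x (e i x)) \<in> reg X W" if "i < Suc n" for i
    proof -
      have "e i \<in> sec E U"
        using local_frame_in_sec[OF X U EG e that] by simp
      then have "(\<lambda>x. \<xi> x (e i x)) \<in> reg X U"
        using \<xi> U by (simp add: sec_dual_bundle)
      then show ?thesis using reg_restrict[OF X U] W by blast
    qed
    have last_reg: "(\<lambda>x. last (\<lambda>i. f i x) x) \<in> reg X W" if "\<forall>i<n. f i \<in> reg X W"
    proof -
      have "(\<lambda>x. (- 1) * (\<Sum>i<n. f i x * \<xi> x (e i x))) \<in> reg X W"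
        using W that reg_\<xi> by (intro reg_mult[OF X] reg_sum[OF X] reg_const[OF X]) auto
      moreover have "(\<lambda>x. inverse (\<xi> x (e n x))) \<in> reg X W"
        using W nz reg_\<xi>[of n] by (intro reg_inverse[OF X]) auto
      ultimately show ?thesis
        using reg_mult[OF X W(1)] by (fastforce simp: last_def)
    qed
    define t where "t = (\<lambda>x. \<Sum>i<n. scl E (f i x) (?e i x))"
    have "t = (\<lambda>x. \<Sum>i<Suc n. scl E (f' i x) (e i x))"
      unfolding t_def sum f'_def by simp
    then have "t \<in> {t \<in> sec E W. \<forall>x\<in>W. t x \<in> G x} \<longleftrightarrow> (\<forall>i<Suc n. f' i \<in> reg X W)"
      using local_frame_sec_iff[OF e W, of f'] by (simp only: restrict_simps)
    moreover have "(\<forall>i<Suc n. f' i \<in> reg X W) \<longleftrightarrow> (\<forall>i<n. f i \<in> reg X W)"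
    proof -
      have "f' n = (\<lambda>x. last (\<lambda>i. f i x) x)" "\<And>i. i < n \<Longrightarrow> f' i = f i"
        by (auto simp: f'_def)
      then show ?thesis using last_reg by (auto simp: less_Suc_eq)
    qed
    moreover have "\<xi> x (t x) = 0" if "x \<in> W" for x
      unfolding t_def using that W(2) by (intro \<xi>_zero) blast
    then have "t \<in> {t \<in> sec E W. \<forall>x\<in>W. t x \<in> {v \<in> G x. \<xi> x v = 0}} \<longleftrightarrow>
        t \<in> {t \<in> sec E W. \<forall>x\<in>W. t x \<in> G x}"
      by simp
    ultimately show "(\<lambda>x. \<Sum>i<n. scl E (f i x) (?e i x)) \<in>
        {t \<in> sec E W. \<forall>x\<in>W. t x \<in> {v \<in> G x. \<xi> x v = 0}} \<longleftrightarrow> (\<forall>i<n. f i \<in> reg X W)"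
      unfolding t_def[symmetric] by (simp only:)
  qed
qed

lemma local_frame_dim:
  assumes "vector_space (scl E)" "local_frame X E U n e" "x \<in> U"
  shows "vector_space.dim (scl E) (fib E x) = n"
    and "module.span (scl E) ((\<lambda>i. e i x) ` {..<n}) = fib E x"
    and "module.subspace (scl E) (fib E x)"
proof -
  interpret vector_space "scl E" by fact
  have e: "inj_on (\<lambda>i. e i x) {..<n}" "independent ((\<lambda>i. e i x) ` {..<n})"
    "span ((\<lambda>i. e i x) ` {..<n}) = fib E x"
    using assms(2,3) unfolding local_frame_def by simp_all
  show "span ((\<lambda>i. e i x) ` {..<n}) = fib E x" by (rule e)
  show "subspace (fib E x)" unfolding e(3)[symmetric] by (rule subspace_span)
  show "dim (fib E x) = n"
    unfolding e(3)[symmetric] using e(1,2) by (simp add: dim_eq_card_independent card_image)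
qed

lemma subspace_common_kernel:
  assumes "vector_space s" "vector_space t" "module.subspace s A"
    and lin: "\<And>h. h \<in> H \<Longrightarrow> linear_map_on s t A C h"
  shows "module.subspace s {v \<in> A. \<forall>h\<in>H. h v = 0}"
proof -
  interpret vector_space_pair s t
    using assms(1,2) by (simp add: vector_space_pair_def)
  have "h 0 = 0" if "h \<in> H" for h
    using linear_map_on_0[OF assms(1,2) _ lin[OF that]] assms(3) vs1.subspace_0 by blast
  then show ?thesis
    using assms(3)
  proof (intro vs1.subspaceI CollectI conjI ballI; clarify?)
    fix u v h
    assume uv: "u \<in> A" "v \<in> A" "\<forall>h\<in>H. h u = 0" "\<forall>h\<in>H. h v = 0" and h: "h \<in> H"
    have "h (u + v) = h u + h v"
      using lin[OF h] uv(1,2) by (simp add: linear_map_on_def)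
    also have "\<dots> = 0 + 0"
      using uv(3,4) h by metis
    finally show "h (u + v) = 0" by simp
  next
    fix c v h
    assume v: "v \<in> A" "\<forall>h\<in>H. h v = 0" and h: "h \<in> H"
    have "h (s c v) = t c (h v)"
      using lin[OF h] v(1) by (simp add: linear_map_on_def)
    also have "\<dots> = t c 0"
      using v(2) h by metis
    finally show "h (s c v) = 0" by simp
  qed (simp_all add: vs1.subspace_def)
qed

text \<open>
  The frame \<open>e\<close> spans a family \<open>G\<close> that contains the common kernel.  If some functional is nonzero on a
  frame vector at \<open>x0\<close>, that vector is moved to the last position and eliminated over the open set where
  the functional stays nonzero on it.  If not, \<open>G\<close> and the kernel coincide at \<open>x0\<close>, so the rank of \<open>G\<close> is
  \<open>r\<close>, and then they coincide everywhere.
\<close>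

lemma local_frame_common_kernel:
  fixes X :: "('x, 'k::field) fun_space" and E :: "('x, 'k, 'v::ab_group_add) vbundle"
  assumes X: "space_with_functions X" and E: "vector_space (scl E)"
  defines "K \<equiv> \<lambda>\<Lambda> x. {v \<in> fib E x. \<forall>\<xi>\<in>\<Lambda>. \<xi> x v = 0}"
  assumes "openin (topo X) U" "x0 \<in> U" "\<Lambda> \<subseteq> sec (dual_bundle X E) U"
    and "\<And>x. x \<in> U \<Longrightarrow> module.subspace (scl E) (fib E x)"
    and "\<And>x. x \<in> U \<Longrightarrow> K \<Lambda> x \<subseteq> G x" "\<And>x. x \<in> U \<Longrightarrow> G x \<subseteq> fib E x"
    and "\<And>x. x \<in> U \<Longrightarrow> vector_space.dim (scl E) (K \<Lambda> x) = r"
    and "local_frame X (restrict_vbundle E G) U n e"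
  shows "\<exists>U' e'. openin (topo X) U' \<and> x0 \<in> U' \<and> local_frame X (restrict_vbundle E (K \<Lambda>)) U' r e'"
  using assms(4-)
proof (induction n arbitrary: U G e rule: less_induct)
  case (less n)
  interpret vector_space "scl E" by fact
  have F: "vector_space ((*) :: 'k \<Rightarrow> 'k \<Rightarrow> 'k)"
    by unfold_locales (auto simp: algebra_simps)
  have EG: "vector_space (scl (restrict_vbundle E G))"
    using E by simp
  note frame = less.prems(8)
  note G_dim = local_frame_dim[OF EG frame, simplified]
  have G_eq: "G x = range (\<lambda>c. \<Sum>i<n. scl E (c i) (e i x))" if "x \<in> U" for x
    using local_frame_fib[OF EG frame that] by simp
  have e_in: "e i x \<in> G x" if "x \<in> U" "i < n" for x i
    using local_frame_in_sec[OF X less.prems(1) EG frame that(2)] that(1) by simp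
  have lin: "linear_map_on (scl E) (*) (fib E x) UNIV (\<xi> x)" if "\<xi> \<in> \<Lambda>" "x \<in> U" for \<xi> x
  proof -
    have "\<xi> \<in> sec (dual_bundle X E) U" using less.prems(3) that(1) by blast
    then show ?thesis using that(2) by (simp add: sec_dual_bundle)
  qed
  show ?case
  proof (cases "\<exists>\<xi>\<in>\<Lambda>. \<exists>i<n. \<xi> x0 (e i x0) \<noteq> 0")
    case False
    have "\<xi> x0 v = 0" if \<xi>: "\<xi> \<in> \<Lambda>" and v: "v \<in> G x0" for \<xi> v
    proof -
      obtain c where "v = (\<Sum>i<n. scl E (c i) (e i x0))"
        using v G_eq[OF less.prems(2)] by blast
      moreover have "\<xi> x0 (\<Sum>i<n. scl E (c i) (e i x0)) = (\<Sum>i<n. c i * \<xi> x0 (e i x0))"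
        using less.prems(2,4) e_in subsetD[OF less.prems(6)]
        by (intro linear_map_on_sum[OF E F _ lin[OF \<xi>]]) auto
      moreover have "\<xi> x0 (e i x0) = 0" if "i < n" for i
        using False \<xi> that by blast
      ultimately show ?thesis by simp
    qed
    then have "K \<Lambda> x0 = G x0"
      using less.prems(2,5,6) unfolding K_def by blast
    then have n: "n = r"
      using G_dim(1)[OF less.prems(2)] less.prems(2,7) by metis
    have "K \<Lambda> x = G x" if x: "x \<in> U" for x
    proof (rule subspace_eq_of_dim_eq[OF E])
      have "subspace {v \<in> fib E x. \<forall>h\<in>(\<lambda>\<xi>. \<xi> x) ` \<Lambda>. h v = 0}"
        using x less.prems(4) lin by (intro subspace_common_kernel[OF E F]) auto
      then show "subspace (K \<Lambda> x)"
        unfolding K_def by simp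
      show "G x \<subseteq> span ((\<lambda>i. e i x) ` {..<n})"
        using G_dim(2)[OF x] by simp
      show "dim (K \<Lambda> x) = dim (G x)"
        using G_dim(1)[OF x] less.prems(7)[OF x] n by simp
    qed (use less.prems(5) x in auto)
    then have "local_frame X (restrict_vbundle E (K \<Lambda>)) U n e"
      using frame local_frame_restrict_cong[of U "K \<Lambda>" G X E n e] by simp
    then show ?thesis
      using less.prems(1,2) n by auto
  next
    case True
    then obtain \<xi> i where \<xi>: "\<xi> \<in> \<Lambda>" and i: "i < n" "\<xi> x0 (e i x0) \<noteq> 0"
      by blast
    then obtain m where m: "n = Suc m"
      using Suc_lessE by (metis less_imp_Suc_add)
    define d where "d = (\<lambda>j. e (transpose i m j))"
    have d: "local_frame X (restrict_vbundle E G) U n d"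
      unfolding d_def using m i(1) by (intro local_frame_transpose[OF EG frame]) auto
    have dm: "d m = e i"
      by (simp add: d_def)
    have \<xi>_sec: "\<xi> \<in> sec (dual_bundle X E) U"
      using less.prems(3) \<xi> by blast
    define U' where "U' = {x \<in> U. \<xi> x (d m x) \<noteq> 0}"
    have "d m \<in> sec E U"
      using local_frame_in_sec[OF X less.prems(1) EG frame i(1)] by (simp add: dm)
    then have "(\<lambda>x. \<xi> x (d m x)) \<in> reg X U"
      using \<xi>_sec less.prems(1) by (simp add: sec_dual_bundle)
    then have U': "openin (topo X) U'"
      unfolding U'_def by (rule open_nonzero[OF X less.prems(1)])
    have "U' \<subseteq> U" by (auto simp: U'_def)
    have \<Lambda>: "\<Lambda> \<subseteq> sec (dual_bundle X E) U'"
    proof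
      fix h assume "h \<in> \<Lambda>"
      then have "h \<in> sec (dual_bundle X E) U" using less.prems(3) by blast
      then show "h \<in> sec (dual_bundle X E) U'"
        using \<open>U' \<subseteq> U\<close> by (auto simp: sec_dual_bundle)
    qed
    let ?G = "\<lambda>x. {v \<in> G x. \<xi> x v = 0}"
    have "local_frame X (restrict_vbundle E ?G) U' m
        (\<lambda>j x. d j x - scl E (\<xi> x (d j x) / \<xi> x (d m x)) (d m x))"
    proof (rule local_frame_hyperplane[OF X U' E])
      show "local_frame X (restrict_vbundle E G) U' (Suc m) d"
        using d \<open>U' \<subseteq> U\<close> m local_frame_subset by blast
    qed (use \<open>U' \<subseteq> U\<close> less.prems(4,6) \<Lambda> \<xi> in \<open>auto simp: U'_def\<close>)
    note IH = less.IH[OF _ U' _ \<Lambda> _ _ _ _ this]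
    show ?thesis
    proof (rule IH)
      fix x assume "x \<in> U'"
      then have x: "x \<in> U" using \<open>U' \<subseteq> U\<close> by blast
      show "K \<Lambda> x \<subseteq> ?G x"
        using less.prems(5)[OF x] \<xi> unfolding K_def by blast
      show "?G x \<subseteq> fib E x"
        using less.prems(6)[OF x] by blast
      show "subspace (fib E x)" "dim (K \<Lambda> x) = r"
        using less.prems(4,7)[OF x] by simp_all
    qed (use m less.prems(2) i(2) in \<open>auto simp: U'_def dm\<close>)
  qed
qed

lemma subbundle_of_constant_rank_kernel:
  fixes X :: "('x, 'k::field) fun_space" and E :: "('x, 'k, 'v::ab_group_add) vbundle"
  assumes X: "space_with_functions X" and E: "vector_bundle X n E"
    and K: "\<And>x. x \<in> points X \<Longrightarrow> \<exists>U \<Lambda>. openin (topo X) U \<and> x \<in> U \<and>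
         \<Lambda> \<subseteq> sec (dual_bundle X E) U \<and> (\<forall>y\<in>U. K y = {v \<in> fib E y. \<forall>\<xi>\<in>\<Lambda>. \<xi> y v = 0})"
    and dim: "\<And>x. x \<in> points X \<Longrightarrow> vector_space.dim (scl E) (K x) = r"
  shows "subbundle X E r K"
proof -
  have vs: "vector_space (scl E)"
    and sub: "\<And>x. x \<in> points X \<Longrightarrow> module.subspace (scl E) (fib E x)"
    and sheaf: "is_sheaf (topo X) (sec E)"
    and sec_fib: "\<And>U t x. openin (topo X) U \<Longrightarrow> t \<in> sec E U \<Longrightarrow> x \<in> U \<Longrightarrow> t x \<in> fib E x"
    and frames: "\<And>x. x \<in> points X \<Longrightarrow> \<exists>U e. openin (topo X) U \<and> x \<in> U \<and> local_frame X E U n e"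
    using E unfolding vector_bundle_def by simp_all
  interpret vector_space "scl E" by fact
  have F: "vector_space ((*) :: 'k \<Rightarrow> 'k \<Rightarrow> 'k)"
    by unfold_locales (auto simp: algebra_simps)
  have pts: "x \<in> points X" if "openin (topo X) U" "x \<in> U" for x U
    using that openin_subset by blast
  have K_sub: "K x \<subseteq> fib E x \<and> subspace (K x)" if x: "x \<in> points X" for x
  proof -
    obtain U \<Lambda> where U: "x \<in> U" "\<Lambda> \<subseteq> sec (dual_bundle X E) U"
        "K x = {v \<in> fib E x. \<forall>\<xi>\<in>\<Lambda>. \<xi> x v = 0}"
      using K[OF x] by blast
    have "linear_map_on (scl E) (*) (fib E x) UNIV (\<xi> x)" if "\<xi> \<in> \<Lambda>" for \<xi>
    proof -
      have "\<xi> \<in> sec (dual_bundle X E) U" using U(2) that by blast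
      then show ?thesis using U(1) by (simp add: sec_dual_bundle)
    qed
    then have "subspace {v \<in> fib E x. \<forall>h\<in>(\<lambda>\<xi>. \<xi> x) ` \<Lambda>. h v = 0}"
      using sub[OF x] by (intro subspace_common_kernel[OF vs F]) auto
    then show ?thesis using U(3) by auto
  qed
  have "is_sheaf (topo X) (\<lambda>U. {t \<in> sec E U. \<forall>x\<in>U. t x \<in> K x})"
    unfolding is_sheaf_def
  proof (intro conjI allI impI)
    fix U s t assume "openin (topo X) U" "s \<in> {t \<in> sec E U. \<forall>x\<in>U. t x \<in> K x}" "\<forall>x\<in>U. t x = s x"
    then show "t \<in> {t \<in> sec E U. \<forall>x\<in>U. t x \<in> K x}"
      using is_sheaf_cong[OF sheaf, of U s t] by simp
  next
    fix U W s assume "openin (topo X) U" "openin (topo X) W" "W \<subseteq> U"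
      "s \<in> {t \<in> sec E U. \<forall>x\<in>U. t x \<in> K x}"
    then show "s \<in> {t \<in> sec E W. \<forall>x\<in>W. t x \<in> K x}"
      using is_sheaf_restrict[OF sheaf, of U W s] by auto
  next
    fix U s assume U: "openin (topo X) U"
      and "\<forall>x\<in>U. \<exists>W. openin (topo X) W \<and> x \<in> W \<and> W \<subseteq> U \<and> s \<in> {t \<in> sec E W. \<forall>x\<in>W. t x \<in> K x}"
    then have *: "\<exists>W. openin (topo X) W \<and> x \<in> W \<and> W \<subseteq> U \<and> s \<in> sec E W" "s x \<in> K x" if "x \<in> U" for x
      using that by fast+
    then show "s \<in> {t \<in> sec E U. \<forall>x\<in>U. t x \<in> K x}"
      using is_sheaf_glue[OF sheaf U] by simp
  qed
  moreover have "\<exists>U e. openin (topo X) U \<and> x \<in> U \<and> local_frame X (restrict_vbundle E K) U r e"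
    if x: "x \<in> points X" for x
  proof -
    obtain U1 e where U1: "openin (topo X) U1" "x \<in> U1" "local_frame X E U1 n e"
      using frames[OF x] by blast
    obtain U2 \<Lambda> where U2: "openin (topo X) U2" "x \<in> U2" "\<Lambda> \<subseteq> sec (dual_bundle X E) U2"
      and K2: "\<forall>y\<in>U2. K y = {v \<in> fib E y. \<forall>\<xi>\<in>\<Lambda>. \<xi> y v = 0}"
      using K[OF x] by blast
    define U where "U = U1 \<inter> U2"
    have U: "openin (topo X) U" "x \<in> U" "U \<subseteq> U1" "U \<subseteq> U2"
      using U1 U2 by (auto simp: U_def)
    have "sec (restrict_vbundle E (fib E)) W = sec E W" if "openin (topo X) W" for W
      using sec_fib[OF that] by auto
    then have frame: "local_frame X (restrict_vbundle E (fib E)) U n e"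
      using local_frame_subset[OF U1(3) U(3)] unfolding local_frame_def by simp
    have \<Lambda>: "\<Lambda> \<subseteq> sec (dual_bundle X E) U"
    proof
      fix h assume "h \<in> \<Lambda>"
      then have "h \<in> sec (dual_bundle X E) U2" using U2(3) by blast
      then show "h \<in> sec (dual_bundle X E) U"
        using U(4) by (auto simp: sec_dual_bundle)
    qed
    have K': "K y = {v \<in> fib E y. \<forall>\<xi>\<in>\<Lambda>. \<xi> y v = 0}" if "y \<in> U" for y
      using K2 U(4) that by blast
    have "\<exists>U' e'. openin (topo X) U' \<and> x \<in> U' \<and>
        local_frame X (restrict_vbundle E (\<lambda>y. {v \<in> fib E y. \<forall>\<xi>\<in>\<Lambda>. \<xi> y v = 0})) U' r e'"
    proof (rule local_frame_common_kernel[OF X vs U(1,2) \<Lambda> _ _ _ _ frame])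
      fix y assume y: "y \<in> U"
      show "subspace (fib E y)"
        using sub pts[OF U(1) y] .
      show "dim {v \<in> fib E y. \<forall>\<xi>\<in>\<Lambda>. \<xi> y v = 0} = r"
        using dim[OF pts[OF U(1) y]] K'[OF y] by simp
    qed auto
    then obtain U' e' where U': "openin (topo X) U'" "x \<in> U'"
      "local_frame X (restrict_vbundle E (\<lambda>y. {v \<in> fib E y. \<forall>\<xi>\<in>\<Lambda>. \<xi> y v = 0})) U' r e'"
      by blast
    then have "local_frame X (restrict_vbundle E K) (U \<inter> U') r e'"
      using K' local_frame_subset[OF U'(3), of "U \<inter> U'"] 
        local_frame_restrict_cong[of "U \<inter> U'" K _ X E r e'] by simp
    moreover have "openin (topo X) (U \<inter> U')" "x \<in> U \<inter> U'"
      using U U' by auto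
    ultimately show ?thesis by blast
  qed
  ultimately show ?thesis
    unfolding subbundle_def vector_bundle_def restrict_simps using vs K_sub
    by (auto simp: restrict_vbundle_def)
qed

section \<open>Forms with values in powers of a line bundle\<close>

text \<open>
  An element of \<open>M \<otimes> M \<otimes> M\<close> is a map that takes two functionals on \<open>M\<close> to a vector of \<open>M\<close>.  Inserting the
  functional dual to \<open>m\<close> twice therefore turns \<open>c (m \<otimes> m \<otimes> m)\<close> into \<open>c m\<close> and makes the coefficient
  accessible.
\<close>

lemma tensor_cube_pure_apply:
  fixes M :: "('x, 'k::field, 'm::ab_group_add) vbundle"
  assumes "vector_space (scl M)" and \<xi>: "\<xi> \<in> fib (dual_bundle X M) x" "\<xi> m = 1"
  shows "scl (tensor_cube X M) c
           (pure_tensor X M (tensor_square X M) x m (pure_tensor X M M x m m)) \<xi> \<xi> = scl M c m"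
proof -
  interpret vector_space "scl M" by fact
  have scl_hom: "scl (tensor_bundle X E F) = (\<lambda>c h v. scl F c (h v))"
    for E :: "('x, 'k, 'p::ab_group_add) vbundle" and F :: "('x, 'k, 'q::ab_group_add) vbundle"
    by (simp add: tensor_bundle_def hom_bundle_def Let_def)
  show ?thesis
    using \<xi> by (simp add: scl_hom pure_tensor_def)
qed

lemma sec_tensor_bundle_apply:
  assumes "h \<in> sec (tensor_bundle X E F) U" "openin (topo X) U" "\<xi> \<in> sec (dual_bundle X E) U"
  shows "(\<lambda>x. h x (\<xi> x)) \<in> sec F U"
  using assms by (simp add: tensor_bundle_def hom_bundle_def Let_def)

text \<open>
  The dual frame of a frame \<open>m\<close> of a line bundle.  It is regular because it takes a section of \<open>M\<close> to its
  coefficient with respect to \<open>m\<close>.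
\<close>

lemma dual_coordinate:
  fixes M :: "('x, 'k::field, 'm::ab_group_add) vbundle"
  assumes M: "line_bundle X M" and U: "openin (topo X) U" and m: "local_frame X M U 1 (\<lambda>_. m)"
  obtains \<xi> where "\<xi> \<in> sec (dual_bundle X M) U" "\<And>x. x \<in> U \<Longrightarrow> \<xi> x (m x) = 1"
proof -
  have vs: "vector_space (scl M)" and
    sec_fib: "\<And>W t x. openin (topo X) W \<Longrightarrow> t \<in> sec M W \<Longrightarrow> x \<in> W \<Longrightarrow> t x \<in> fib M x"
    using M unfolding vector_bundle_def by simp_all
  interpret vector_space "scl M" by fact
  define \<xi> where "\<xi> x v = (if v \<in> fib M x then (THE c. v = scl M c (m x)) else 0)" for x v
  have fib: "fib M x = range (\<lambda>c. scl M c (m x))" and nz: "m x \<noteq> 0" if x: "x \<in> U" for x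
  proof -
    have "fib M x = range (\<lambda>c::nat \<Rightarrow> 'k. scl M (c 0) (m x))"
      using local_frame_fib[OF vs m x] by simp
    moreover have "range (\<lambda>c::nat \<Rightarrow> 'k. scl M (c 0) (m x)) = range (\<lambda>c. scl M c (m x))"
    proof
      show "range (\<lambda>c. scl M c (m x)) \<subseteq> range (\<lambda>c::nat \<Rightarrow> 'k. scl M (c 0) (m x))"
      proof clarify
        fix c show "scl M c (m x) \<in> range (\<lambda>c::nat \<Rightarrow> 'k. scl M (c 0) (m x))"
          by (rule range_eqI[of _ _ "\<lambda>_. c"]) simp
      qed
    qed auto
    ultimately show "fib M x = range (\<lambda>c. scl M c (m x))" by simp
    show "m x \<noteq> 0"
      using local_frame_coeff_zero[OF vs m x, of "\<lambda>_. 1" 0] by auto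
  qed
  have \<xi>: "\<xi> x (scl M c (m x)) = c" if "x \<in> U" for x c
    using fib[OF that] nz[OF that] by (simp add: \<xi>_def)
  have lin: "linear_map_on (scl M) (*) (fib M x) UNIV (\<xi> x)" if "x \<in> U" for x
    unfolding fib[OF that]
    by (auto simp: linear_map_on_def \<xi>[OF that] simp flip: scale_left_distrib)
  have "(\<lambda>x. \<xi> x (t x)) \<in> reg X W" if W: "openin (topo X) W" "W \<subseteq> U" and t: "t \<in> sec M W" for W t
  proof (rule local_frame_coeff_regular[OF M m W t, where k = 0])
    fix x assume "x \<in> W"
    then have x: "x \<in> U" and "t x \<in> fib M x"
      using W t sec_fib by auto
    then obtain c where "t x = scl M c (m x)"
      using fib by auto
    then show "t x = (\<Sum>i<(1::nat). scl M (\<xi> x (t x)) (m x))"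
      by (simp add: \<xi>[OF x])
  qed simp
  then have "\<xi> \<in> sec (dual_bundle X M) U"
    using lin by (auto simp: sec_dual_bundle \<xi>_def)
  moreover have "\<xi> x (m x) = 1" if "x \<in> U" for x
    using \<xi>[OF that, of 1] by simp
  ultimately show thesis by (rule that)
qed

lemma sec_dual_bundleD: "\<xi> \<in> sec (dual_bundle X E) U \<Longrightarrow> x \<in> U \<Longrightarrow> \<xi> x \<in> fib (dual_bundle X E) x"
  by (simp add: dual_bundle_def hom_bundle_def Let_def)

lemma sec_dual_bundle_mono:
  "\<xi> \<in> sec (dual_bundle X E) U \<Longrightarrow> W \<subseteq> U \<Longrightarrow> \<xi> \<in> sec (dual_bundle X E) W"
  by (auto simp: sec_dual_bundle)

lemma tensor_cube_coeff_regular: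
  fixes M :: "('x, 'k::field, 'm::ab_group_add) vbundle"
  assumes M: "line_bundle X M" and U: "openin (topo X) U" and m: "local_frame X M U 1 (\<lambda>_. m)"
    and W: "openin (topo X) W" "W \<subseteq> U" and t: "t \<in> sec (tensor_cube X M) W"
    and c: "\<And>x. x \<in> W \<Longrightarrow> t x = scl (tensor_cube X M) (c x)
              (pure_tensor X M (tensor_square X M) x (m x) (pure_tensor X M M x (m x) (m x)))"
  shows "c \<in> reg X W"
proof -
  have vs: "vector_space (scl M)"
    using M unfolding vector_bundle_def by simp
  obtain \<xi> where \<xi>: "\<xi> \<in> sec (dual_bundle X M) U" "\<And>x. x \<in> U \<Longrightarrow> \<xi> x (m x) = 1"
    using dual_coordinate[OF M U m] by blast
  have \<xi>W: "\<xi> \<in> sec (dual_bundle X M) W"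
    using \<xi>(1) W(2) by (rule sec_dual_bundle_mono)
  have "(\<lambda>x. t x (\<xi> x) (\<xi> x)) \<in> sec M W"
    using sec_tensor_bundle_apply[OF sec_tensor_bundle_apply[OF t W(1) \<xi>W] W(1) \<xi>W] .
  then show ?thesis
  proof (rule local_frame_coeff_regular[OF M m W, where k = 0 and f = "\<lambda>_. c"])
    fix x assume x: "x \<in> W"
    then have "\<xi> x \<in> fib (dual_bundle X M) x" "\<xi> x (m x) = 1"
      using sec_dual_bundleD[OF \<xi>W] \<xi>(2) W(2) by auto
    then show "t x (\<xi> x) (\<xi> x) = (\<Sum>i<(1::nat). scl M (c x) (m x))"
      using tensor_cube_pure_apply[OF vs] by (simp add: c[OF x])
  qed simp
qed


lemma tensor_cube_scl_eq_0_iff: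
  fixes M :: "('x, 'k::field, 'm::ab_group_add) vbundle"
  assumes M: "line_bundle X M" and U: "openin (topo X) U" and m: "local_frame X M U 1 (\<lambda>_. m)"
    and x: "x \<in> U"
  shows "scl (tensor_cube X M) c
      (pure_tensor X M (tensor_square X M) x (m x) (pure_tensor X M M x (m x) (m x))) = 0 \<longleftrightarrow> c = 0"
    (is "?t = 0 \<longleftrightarrow> _")
proof -
  have vs: "vector_space (scl M)"
    using M unfolding vector_bundle_def by simp
  interpret vector_space "scl M" by fact
  obtain \<xi> where \<xi>: "\<xi> \<in> sec (dual_bundle X M) U" "\<And>x. x \<in> U \<Longrightarrow> \<xi> x (m x) = 1"
    using dual_coordinate[OF M U m] by blast
  have "m x \<noteq> 0"
    using local_frame_coeff_zero[OF vs m x, of "\<lambda>_. 1" 0] by auto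
  then have "c = 0" if "?t = 0"
    using tensor_cube_pure_apply[OF vs sec_dual_bundleD[OF \<xi>(1) x] \<xi>(2)[OF x], of c] that by simp
  moreover have "?t = 0" if "c = 0"
    using that by (simp add: tensor_bundle_def hom_bundle_def Let_def zero_fun_def)
  ultimately show ?thesis by blast
qed

text \<open>Spells out when the nested, zero-extended maps of the contraction vanish.\<close>

lemma kernel_contraction:
  assumes "F x \<subseteq> fib V x"
  shows "kernel V (contraction V \<gamma> F) x = {v \<in> fib V x. \<forall>f\<in>F x. \<forall>w\<in>fib V x. \<gamma> x f v w = 0}"
proof -
  have "contraction V \<gamma> F x v = 0 \<longleftrightarrow> (\<forall>f\<in>F x. \<forall>w\<in>fib V x. \<gamma> x f v w = 0)"
    if "v \<in> fib V x" for v
  proof -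
    have "contraction V \<gamma> F x v = 0 \<longleftrightarrow>
        (\<forall>f w. (if f \<in> F x then if w \<in> fib V x then \<gamma> x f v w else 0 else 0) = 0)"
      using that by (simp add: contraction_def fun_eq_iff if_distrib[of "\<lambda>h. h _"] cong: if_cong)
    also have "\<dots> \<longleftrightarrow> (\<forall>f\<in>F x. \<forall>w\<in>fib V x. \<gamma> x f v w = 0)"
      by meson
    finally show ?thesis .
  qed
  then show ?thesis unfolding kernel_def by blast
qed

text \<open>
  The scalar forms \<open>g\<close> and \<open>b\<close> describe \<open>\<gamma>\<close> and \<open>\<beta>\<close> at the point \<open>y\<close> when \<open>M\<close> is trivialized by its
  nonzero vector \<open>m\<close> there.
\<close>

definition compatible_coordinates ::
  "('x, 'k::field) fun_space \<Rightarrow> ('x, 'k, 'v::ab_group_add) vbundle \<Rightarrow>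
     ('x, 'k, 'm::ab_group_add) vbundle \<Rightarrow>
     ('x \<Rightarrow> 'v \<Rightarrow> 'v \<Rightarrow> 'v \<Rightarrow> ('m \<Rightarrow> 'k) \<Rightarrow> ('m \<Rightarrow> 'k) \<Rightarrow> 'm) \<Rightarrow>
     ('x \<Rightarrow> 'v \<Rightarrow> 'v \<Rightarrow> ('m \<Rightarrow> 'k) \<Rightarrow> 'm) \<Rightarrow>
     'x \<Rightarrow> 'm \<Rightarrow> ('v \<Rightarrow> 'v \<Rightarrow> 'v \<Rightarrow> 'k) \<Rightarrow> ('v \<Rightarrow> 'v \<Rightarrow> 'k) \<Rightarrow> bool" where
  "compatible_coordinates X V M \<gamma> \<beta> y m g b \<longleftrightarrow>
     (\<forall>u\<in>fib V y. \<forall>v\<in>fib V y. \<forall>w\<in>fib V y.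
        \<gamma> y u v w = scl (tensor_cube X M) (g u v w)
          (pure_tensor X M (tensor_square X M) y m (pure_tensor X M M y m m))) \<and>
     (\<forall>u\<in>fib V y. \<forall>v\<in>fib V y.
        \<beta> y u v = scl (tensor_square X M) (b u v) (pure_tensor X M M y m m)) \<and>
     compatible (scl V) (fib V y) g b"

lemma compatible_coordinatesD:
  assumes "compatible_coordinates X V M \<gamma> \<beta> y m g b"
  shows "u \<in> fib V y \<Longrightarrow> v \<in> fib V y \<Longrightarrow> w \<in> fib V y \<Longrightarrow>
           \<gamma> y u v w = scl (tensor_cube X M) (g u v w)
             (pure_tensor X M (tensor_square X M) y m (pure_tensor X M M y m m))"
    and "u \<in> fib V y \<Longrightarrow> v \<in> fib V y \<Longrightarrow>
           \<beta> y u v = scl (tensor_square X M) (b u v) (pure_tensor X M M y m m)"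
    and "compatible (scl V) (fib V y) g b"
    and "alternating_trilinear (scl V) (*) (fib V y) UNIV g"
  using assms by (simp_all add: compatible_coordinates_def compatible_def)

text \<open>
  The kernel is defined by all vectors of the line \<open>F y\<close>, but a generator \<open>f\<close> suffices by linearity, and
  the vanishing of \<open>\<gamma>\<close> is that of its coordinate form \<open>g\<close>.
\<close>

lemma kernel_contraction_coordinates:
  fixes V :: "('x, 'k::field, 'v::ab_group_add) vbundle"
    and M :: "('x, 'k::field, 'm::ab_group_add) vbundle"
  assumes M: "line_bundle X M" "openin (topo X) U" "local_frame X M U 1 (\<lambda>_. m)" "y \<in> U"
    and V: "vector_space (scl V)"
    and gb: "compatible_coordinates X V M \<gamma> \<beta> y (m y) g b"
    and f: "f \<in> fib V y" "F y = module.span (scl V) {f}" "F y \<subseteq> fib V y"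
  shows "kernel V (contraction V \<gamma> F) y = {v \<in> fib V y. \<forall>w\<in>fib V y. g f v w = 0}"
proof -
  interpret vector_space "scl V" by fact
  have \<gamma>_iff: "\<gamma> y u v w = 0 \<longleftrightarrow> g u v w = 0"
    if "u \<in> fib V y" "v \<in> fib V y" "w \<in> fib V y" for u v w
    using compatible_coordinatesD(1)[OF gb that] tensor_cube_scl_eq_0_iff[OF M] by simp
  have scale: "g (scl V c f) v w = c * g f v w" if "v \<in> fib V y" "w \<in> fib V y" for c v w
    using compatible_coordinatesD(4)[OF gb] f(1) that
    by (simp add: alternating_trilinear_def linear_map_on_def)
  have "(\<forall>f'\<in>F y. \<forall>w\<in>fib V y. \<gamma> y f' v w = 0) \<longleftrightarrow> (\<forall>w\<in>fib V y. g f v w = 0)"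
    if v: "v \<in> fib V y" for v
  proof (intro iffI ballI)
    fix w assume "\<forall>f'\<in>F y. \<forall>w\<in>fib V y. \<gamma> y f' v w = 0" "w \<in> fib V y"
    moreover have "f \<in> F y" using f(2) span_base by blast
    ultimately show "g f v w = 0" using \<gamma>_iff[OF f(1) v] by blast
  next
    fix f' w assume "\<forall>w\<in>fib V y. g f v w = 0" and f': "f' \<in> F y" and w: "w \<in> fib V y"
    moreover obtain c where "f' = scl V c f"
      using f' f(2) by (auto simp: span_singleton)
    moreover have "f' \<in> fib V y" using f' f(3) by blast
    ultimately show "\<gamma> y f' v w = 0"
      using \<gamma>_iff[of f' v w] v w scale by simp
  qed
  then show ?thesis
    unfolding kernel_contraction[where x = y and F = F and V = V, OF f(3)] by blast
qed

text \<open>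
  The isotropic plane through the line \<open>F y\<close> provides the second vector \<open>p\<close> that
  \<open>compatible_annihilator\<close> asks for.
\<close>

lemma kernel_contraction_fiber:
  fixes V :: "('x, 'k::field, 'v::ab_group_add) vbundle"
    and M :: "('x, 'k::field, 'm::ab_group_add) vbundle"
  assumes two: "(2::'k) \<noteq> 0"
    and M: "line_bundle X M" "openin (topo X) U" "local_frame X M U 1 (\<lambda>_. m)" "y \<in> U"
    and V: "vector_space (scl V)" "local_frame X V W 7 e" "y \<in> W"
    and gb: "compatible_coordinates X V M \<gamma> \<beta> y (m y) g b"
    and F: "gamma_isotropic_line (scl V) (fib V y) (\<gamma> y) (F y)"
    and f: "f \<noteq> 0" "F y = module.span (scl V) {f}"
  shows "vector_space.dim (scl V) (kernel V (contraction V \<gamma> F) y) = 3"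
    and "\<And>u v. u \<in> kernel V (contraction V \<gamma> F) y \<Longrightarrow> v \<in> kernel V (contraction V \<gamma> F) y \<Longrightarrow>
           \<beta> y u v = 0"
proof -
  interpret vector_space "scl V" by fact
  interpret M: vector_space "scl M"
    using M(1) unfolding vector_bundle_def by simp
  obtain P where "gamma_isotropic_plane (scl V) (fib V y) (\<gamma> y) P" and FP: "F y \<subseteq> P"
    using F unfolding gamma_isotropic_line_def by blast
  then have P: "P \<subseteq> fib V y" "dim P = 2" "\<forall>u\<in>P. \<forall>v\<in>P. \<forall>w\<in>fib V y. \<gamma> y u v w = 0"
    unfolding gamma_isotropic_plane_def by simp_all
  have fP: "f \<in> P" using FP f(2) span_base by blast
  have "\<not> P \<subseteq> span {f}"
  proof
    assume "P \<subseteq> span {f}"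
    then have "dim P \<le> card {f}" by (rule dim_le_card) simp
    then show False using P(2) by simp
  qed
  then obtain p where p: "p \<in> P" "p \<notin> span {f}" by blast
  have fp: "f \<in> fib V y" "p \<in> fib V y" using fP p P(1) by blast+
  have g_fp: "\<forall>w\<in>fib V y. g f p w = 0"
  proof
    fix w assume w: "w \<in> fib V y"
    have "\<gamma> y f p w = 0" using P(3) fP p(1) w by blast
    then show "g f p w = 0"
      using compatible_coordinatesD(1)[OF gb fp w] tensor_cube_scl_eq_0_iff[OF M] by simp
  qed
  note K = kernel_contraction_coordinates[where y = y and F = F and \<gamma> = \<gamma> and m = m,
      OF M V(1) gb fp(1) f(2) order_trans[OF FP P(1)]]
  note dim_V = local_frame_dim[OF V]
  have "fib V y \<subseteq> span ((\<lambda>i. e i y) ` {..<7})"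
    using dim_V(2) by simp
  note annihilator = compatible_annihilator[OF V(1) dim_V(3) _ this dim_V(1)
      compatible_coordinatesD(3)[OF gb] two fp(1) f(1) fp(2) p(2) g_fp]
  show "dim (kernel V (contraction V \<gamma> F) y) = 3"
    unfolding K by (rule annihilator(1)) simp
  fix u v assume uv: "u \<in> kernel V (contraction V \<gamma> F) y" "v \<in> kernel V (contraction V \<gamma> F) y"
  then have "b u v = 0"
    unfolding K by (intro annihilator(2)) simp_all
  moreover have "u \<in> fib V y" "v \<in> fib V y"
    using uv by (simp_all add: kernel_def)
  ultimately show "\<beta> y u v = 0"
    using compatible_coordinatesD(2)[OF gb]
    by (simp add: tensor_bundle_def hom_bundle_def Let_def zero_fun_def)
qed

section \<open>The kernel bundle\<close>

text \<open>
  One open set over which \<open>V\<close>, \<open>M\<close> and the line bundle \<open>F\<close> are all trivial and the forms have compatible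
  coordinates.  Nothing is claimed about how the scalar forms \<open>g y\<close> and \<open>b y\<close> vary with \<open>y\<close>.
\<close>

lemma local_trivializations:
  fixes V :: "('x, 'k::field, 'v::ab_group_add) vbundle"
  assumes X: "space_with_functions X" and V: "vector_bundle X n V"
    and F: "subbundle X V 1 F" and compat: "locally_compatible X V M \<gamma> \<beta>"
    and x: "x \<in> points X"
  obtains U e l m g b where "openin (topo X) U" "x \<in> U"
    and "local_frame X V U n e" "local_frame X M U 1 (\<lambda>_. m)"
    and "l \<in> sec V U" "\<And>y. y \<in> U \<Longrightarrow> l y \<noteq> 0" "\<And>y. y \<in> U \<Longrightarrow> F y = module.span (scl V) {l y}"
    and "\<And>y. y \<in> U \<Longrightarrow> compatible_coordinates X V M \<gamma> \<beta> y (m y) (g y) (b y)"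
proof -
  have vs: "vector_space (scl V)" and sheaf: "is_sheaf (topo X) (sec V)"
    using V by (simp_all add: vector_bundle_def)
  obtain U1 e where U1: "openin (topo X) U1" "x \<in> U1" "local_frame X V U1 n e"
    using V x unfolding vector_bundle_def by meson
  obtain U2 ls where U2: "openin (topo X) U2" "x \<in> U2" "local_frame X (restrict_vbundle V F) U2 1 ls"
    using F x unfolding subbundle_def vector_bundle_def by meson
  interpret vector_space "scl V" by fact
  have vsF: "vector_space (scl (restrict_vbundle V F))"
    using vs by simp
  have l: "ls 0 \<in> sec V U2"
    using local_frame_in_sec[OF X U2(1) vsF U2(3), of 0] by simp
  have l_nz: "ls 0 y \<noteq> 0" if "y \<in> U2" for y
    using local_frame_coeff_zero[OF vsF U2(3) that, of "\<lambda>_. 1" 0]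
      by auto
  have l_span: "F y = module.span (scl V) {ls 0 y}" if "y \<in> U2" for y
    using local_frame_dim(2)[OF vsF U2(3) that] by (simp add: lessThan_Suc)
  obtain U3 m where U3: "openin (topo X) U3" "x \<in> U3" "local_frame X M U3 1 (\<lambda>_. m)"
    and "\<forall>y\<in>U3. \<exists>g b. compatible_coordinates X V M \<gamma> \<beta> y (m y) g b"
    using bspec[OF compat[unfolded locally_compatible_def] x]
    unfolding compatible_coordinates_def by (elim exE conjE)
  then obtain g b where gb: "\<forall>y\<in>U3. compatible_coordinates X V M \<gamma> \<beta> y (m y) (g y) (b y)"
    by metis
  show thesis
  proof (rule that[of "U1 \<inter> U2 \<inter> U3" e m "ls 0" g b])
    show U: "openin (topo X) (U1 \<inter> U2 \<inter> U3)"
      using U1 U2 U3 by auto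
    show "local_frame X V (U1 \<inter> U2 \<inter> U3) n e" "local_frame X M (U1 \<inter> U2 \<inter> U3) 1 (\<lambda>_. m)"
      by (rule local_frame_subset[OF U1(3)], blast) (rule local_frame_subset[OF U3(3)], blast)
    show "ls 0 \<in> sec V (U1 \<inter> U2 \<inter> U3)"
      using is_sheaf_restrict[OF sheaf U2(1) U _ l] by auto
  qed (use U1 U2 U3 gb l_nz l_span in auto)
qed

lemma two_nonzero:
  assumes "CHAR('k::field) \<noteq> 2"
  shows "(2::'k) \<noteq> 0"
proof
  assume "(2::'k) = 0"
  then have "CHAR('k) dvd 2"
    using of_nat_eq_0_iff_char_dvd[of 2, where 'a = 'k] by simp
  then have "CHAR('k) = 1 \<or> CHAR('k) = 2"
    using two_is_prime_nat unfolding prime_nat_iff by blast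
  then show False
    using assms CHAR_not_1[where 'a = 'k] by auto
qed

theorem proposition3p15:
  fixes X :: "('x, 'k::alg_closed_field) fun_space"
    and V :: "('x, 'k, 'v::ab_group_add) vbundle"
    and M :: "('x, 'k, 'm::ab_group_add) vbundle"
    and \<gamma> :: "'x \<Rightarrow> 'v \<Rightarrow> 'v \<Rightarrow> 'v \<Rightarrow> ('m \<Rightarrow> 'k) \<Rightarrow> ('m \<Rightarrow> 'k) \<Rightarrow> 'm"
    and \<beta> :: "'x \<Rightarrow> 'v \<Rightarrow> 'v \<Rightarrow> ('m \<Rightarrow> 'k) \<Rightarrow> 'm"
    and F\<^sub>1 :: "'x \<Rightarrow> 'v set"
  assumes "CHAR('k) \<noteq> 2"
    and "variety X"
    and "vector_bundle X 7 V"
    and "line_bundle X M"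
    and "wedge3_form X V (tensor_cube X M) \<gamma>"
    and "sym2_form X V (tensor_square X M) \<beta>"
    and "nondegenerate_form X V \<beta>"
    and "locally_compatible X V M \<gamma> \<beta>"
    and "gamma_isotropic_line_subbundle X V \<gamma> F\<^sub>1"
  defines "\<phi> \<equiv> contraction V \<gamma> F\<^sub>1"
  shows "subbundle X V 3 (kernel V \<phi>) \<and> beta_isotropic X \<beta> (kernel V \<phi>)"
proof -
  have X: "space_with_functions X"
    using assms(2) by (simp add: variety_def)
  have vs: "vector_space (scl V)" and sheaf: "is_sheaf (topo X) (sec V)"
    and sec_fib: "\<And>W t y. openin (topo X) W \<Longrightarrow> t \<in> sec V W \<Longrightarrow> y \<in> W \<Longrightarrow> t y \<in> fib V y"
    using assms(3) by (simp_all add: vector_bundle_def)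
  interpret vector_space "scl V" by fact
  have F: "subbundle X V 1 F\<^sub>1" "\<And>x. x \<in> points X \<Longrightarrow> F\<^sub>1 x \<subseteq> fib V x"
    "\<And>x. x \<in> points X \<Longrightarrow> gamma_isotropic_line (scl V) (fib V x) (\<gamma> x) (F\<^sub>1 x)"
    using assms(9) by (simp_all add: gamma_isotropic_line_subbundle_def subbundle_def)
  note local_trivializations = local_trivializations[OF X assms(3) F(1) assms(8)]
  have dim: "dim (kernel V \<phi> x) = 3"
    and iso: "\<And>u v. u \<in> kernel V \<phi> x \<Longrightarrow> v \<in> kernel V \<phi> x \<Longrightarrow> \<beta> x u v = 0"
    if x: "x \<in> points X" for x
  proof -
    obtain U e l m g b where U: "openin (topo X) U" "x \<in> U"
      and e: "local_frame X V U 7 e" and m: "local_frame X M U 1 (\<lambda>_. m)"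
      and l: "\<And>y. y \<in> U \<Longrightarrow> l y \<noteq> 0" "\<And>y. y \<in> U \<Longrightarrow> F\<^sub>1 y = span {l y}"
      and gb: "\<And>y. y \<in> U \<Longrightarrow> compatible_coordinates X V M \<gamma> \<beta> y (m y) (g y) (b y)"
      using local_trivializations[OF x] by metis
    note fiber = kernel_contraction_fiber[where F = F\<^sub>1 and \<gamma> = \<gamma> and \<beta> = \<beta> and y = x and m = m,
        OF two_nonzero[OF assms(1)] assms(4) U(1) m U(2) vs e U(2) gb[OF U(2)] F(3)[OF x]
          l(1)[OF U(2)] l(2)[OF U(2)]]
    show "dim (kernel V \<phi> x) = 3"
      unfolding \<phi>_def by (rule fiber(1))
    show "\<And>u v. u \<in> kernel V \<phi> x \<Longrightarrow> v \<in> kernel V \<phi> x \<Longrightarrow> \<beta> x u v = 0"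
      unfolding \<phi>_def by (rule fiber(2))
  qed
  have "subbundle X V 3 (kernel V \<phi>)"
  proof (rule subbundle_of_constant_rank_kernel[OF X assms(3) _ dim])
    fix x assume x: "x \<in> points X"
    obtain U e l m g b where U: "openin (topo X) U" "x \<in> U"
      and e: "local_frame X V U 7 e" and m: "local_frame X M U 1 (\<lambda>_. m)"
      and l: "l \<in> sec V U" "\<And>y. y \<in> U \<Longrightarrow> F\<^sub>1 y = span {l y}"
      and gb: "\<And>y. y \<in> U \<Longrightarrow> compatible_coordinates X V M \<gamma> \<beta> y (m y) (g y) (b y)"
      using local_trivializations[OF x] by metis
    \<comment> \<open>Regularity of these functionals comes from \<open>\<gamma>\<close>, whose value on regular sections has the
      coefficient \<open>g y (l y) (s y) (t y)\<close> in the trivialization of the third power of \<open>M\<close>.\<close>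
    define \<xi> where "\<xi> t y v = (if v \<in> fib V y then g y (l y) v (t y) else 0)" for t y v
    have \<xi>_sec: "\<xi> t \<in> sec (dual_bundle X V) U" if t: "t \<in> sec V U" for t
    proof -
      have "(\<lambda>y. \<xi> t y (s y)) \<in> reg X W"
        if W: "openin (topo X) W" "W \<subseteq> U" and s: "s \<in> sec V W" for W s
      proof (rule tensor_cube_coeff_regular[OF assms(4) U(1) m W])
        have "l \<in> sec V W" "t \<in> sec V W"
          using is_sheaf_restrict[OF sheaf U(1) W] l(1) t by simp_all
        then show "(\<lambda>y. \<gamma> y (l y) (s y) (t y)) \<in> sec (tensor_cube X M) W"
          using assms(5) W(1) s by (simp add: wedge3_form_def)
        fix y assume y: "y \<in> W"
        then have yU: "y \<in> U" using W(2) by blast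
        have mem: "l y \<in> fib V y" "s y \<in> fib V y" "t y \<in> fib V y"
          using sec_fib[OF U(1) l(1) yU] sec_fib[OF W(1) s y] sec_fib[OF U(1) t yU] .
        show "\<gamma> y (l y) (s y) (t y) = scl (tensor_cube X M) (\<xi> t y (s y))
            (pure_tensor X M (tensor_square X M) y (m y) (pure_tensor X M M y (m y) (m y)))"
          using compatible_coordinatesD(1)[OF gb[OF yU] mem] mem by (simp add: \<xi>_def)
      qed
      moreover have "linear_map_on (scl V) (*) (fib V y) UNIV (\<xi> t y)" if y: "y \<in> U" for y
      proof -
        have "l y \<in> fib V y" "t y \<in> fib V y" "subspace (fib V y)"
          using sec_fib[OF U(1)] l(1) t y local_frame_dim(3)[OF vs e] by simp_all
        then show ?thesis
          using compatible_coordinatesD(4)[OF gb[OF y]]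
          by (simp add: alternating_trilinear_def linear_map_on_def \<xi>_def subspace_add subspace_scale)
      qed
      ultimately show ?thesis
        by (simp add: sec_dual_bundle \<xi>_def)
    qed
    have "kernel V \<phi> y = {v \<in> fib V y. \<forall>h\<in>\<xi> ` sec V U. h y v = 0}" if y: "y \<in> U" for y
    proof -
      have "y \<in> points X" using U(1) y openin_subset by blast
      then have "kernel V \<phi> y = {v \<in> fib V y. \<forall>w\<in>fib V y. g y (l y) v w = 0}"
        unfolding \<phi>_def
        by (intro kernel_contraction_coordinates[where y = y and F = F\<^sub>1 and \<gamma> = \<gamma> and m = m,
              OF assms(4) U(1) m y vs gb[OF y] sec_fib[OF U(1) l(1) y] l(2)[OF y]] F(2))
      moreover have "(\<forall>w\<in>fib V y. g y (l y) v w = 0) \<longleftrightarrow> (\<forall>t\<in>sec V U. g y (l y) v (t y) = 0)" for v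
      proof
        \<comment> \<open>Every vector of the fiber is the value of a section over \<open>U\<close>, as \<open>V\<close> has a frame there.\<close>
        assume *: "\<forall>t\<in>sec V U. g y (l y) v (t y) = 0"
        show "\<forall>w\<in>fib V y. g y (l y) v w = 0"
        proof
          fix w assume "w \<in> fib V y"
          then obtain t where "t \<in> sec V U" "t y = w"
            using local_frame_section[OF X U(1) vs e y] by blast
          then show "g y (l y) v w = 0" using * by blast
        qed
      qed (use sec_fib[OF U(1) _ y] in blast)
      ultimately show ?thesis by (auto simp: \<xi>_def)
    qed
    then show "\<exists>U \<Lambda>. openin (topo X) U \<and> x \<in> U \<and> \<Lambda> \<subseteq> sec (dual_bundle X V) U \<and>
        (\<forall>y\<in>U. kernel V \<phi> y = {v \<in> fib V y. \<forall>\<xi>\<in>\<Lambda>. \<xi> y v = 0})"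
      using U \<xi>_sec by (intro exI[of _ U] exI[of _ "\<xi> ` sec V U"]) auto
  qed
  then show ?thesis
    using iso unfolding beta_isotropic_def by blast
qed

end
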